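(* Let $\mathcal M$ be an $\mathfrak L$-structure. Then $\mathcal M$ is a model of $T_{BML}$ if and only if $\mathcal M$, viewed as an $L^{pr}$-structure, is a model of $\mathsf{PR}$; that is, if and only if there are interpretations of the symbols $\cap$, $\cdot^c$, $\mu$ on $\mathcal M$ which, together with $0$, $1$, $d$ and $\cup:=+$ of $\mathcal M$, make $\mathcal M$ an $L^{pr}$-structure which is a model of $\mathsf{PR}$.
   Context: We use continuous first-order logic of metric structures; a theory's sentences are required to take the value $0$ in a model. A function has modulus of uniform continuity $\Delta$ if, whenever all coordinates of two tuples are within $\Delta(\varepsilon)$, the values are within $\varepsilon$. The language $\mathfrak L$ has one sort (a complete metric space $(X,d)$ of diameter $1$), constants $0,1$, and a binary function symbol $+$ that is contractive when $X\times X$ carries the $\ell^1$-metric. Write $|x|=d(x,0)$, $a\mathbin{\dot-}b=\max\{a-b,0\}$, $d'(x,y)=d(x+y,x)+d(x+y,y)$. $T_{ML}$ consists of: $d(0,1)=1$; $\sup_x d(x+0,x)+d(x+1,1)$; $\sup_x d(x+x,x)$; $\sup_{x,y}d(x+y,y+x)$; $\sup_{x,y,z}d((x+y)+z,x+(y+z))$; $\sup_{x,y,z}(d(x+z,y+z)\mathbin{\dot-}d(x,y))$; $\sup_{x,y,z}\bigl([d(x,y)+d(z,0)]\mathbin{\dot-}[d(x+y,0)+d(x+z,x)+d(y+z,y)]\bigr)$. Every model of $T_{ML}$ is a complete lattice under $x\le y\iff x+y=y$, with join $+$; the meet is written $xy$. Let $\sigma_{\mathrm{mod}}=\sup_{x,y}\inf_z\max\{(|x|+|y|)\mathbin{\dot-}(|x+y|+|z|),\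 d(x+z,x),\ d(y+z,y)\}$ and $T_{MML}=T_{ML}\cup\{\sigma_{\mathrm{mod}}\}$. Let $\phi_m(x,y,z)$ be a definable predicate of $\mathfrak L$ with $\phi_m^{\mathcal M}(x,y,z)=d(xy,z)$ in all models $\mathcal M$ of $T_{MML}$ (such a predicate exists). Let $\sigma_{\mathrm{dist}}=\sup_{x,y,z}\inf_{t,w}\max\{\phi_m(x,y,t),\phi_m(x,z,w),\phi_m(x,y+z,t+w)\}$, $\sigma_{\mathrm{wcom}}=\sup_x\inf_y(1-d(x,y))$, $\sigma_{d=d'}=\sup_{x,y}|d(x,y)-d'(x,y)|$, and $T_{BML}=T_{MML}\cup\{\sigma_{\mathrm{dist}},\sigma_{\mathrm{wcom}},\sigma_{d=d'}\}$. The signature $L^{pr}$ has a unary predicate $\mu$ with modulus $\Delta_\mu(\varepsilon)=\varepsilon$, binary functions $\cap,\cup$ with modulus $\varepsilon/2$, a unary function $\cdot^c$ with modulus $\varepsilon$, and constants $0,1$. The theory $\mathsf{PR}$ consists of: the Boolean algebra axioms for $(\cup,\cap,\cdot^c,0,1)$ (each identity $s=t$ expressed as $\sup d(s,t)=0$); the measure axioms $\mu(0)=0$, $\mu(1)=1$, $\sup_{x,y}(\mu(x\cap y)\mathbin{\dot-}\mu(x))=0$, $\sup_{x,y}(\mu(x)\mathbin{\dot-}\mu(x\cup y))=0$, $\sup_{x,y}|(\mu(x)\mathbin{\dot-}\mu(x\cap y))-(\mu(x\cup y)\mathbin{\dot-}\mu(y))|=0$; and $\sup_{x,y}|d(x,y)-\mu(x\Delta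 y)|=0$, where $x\Delta y=(x\cap y^c)\cup(x^c\cap y)$. *)

theory Defs
  imports "HOL-Analysis.Analysis"
begin

(* Sentences and formulas are represented by their interpretations: a sentence of a language is the
   function that sends each structure to the value of the sentence in it, and a theory is a set of
   such functions.  Which functions are interpretations of formulas is fixed below (L_formula). *)

type_synonym 's sentence = "'s \<Rightarrow> real"

definition models :: "'s \<Rightarrow> 's sentence set \<Rightarrow> bool" (infix "\<Turnstile>" 50) where
  "M \<Turnstile> T \<longleftrightarrow> (\<forall>\<sigma>\<in>T. \<sigma> M = 0)"

definition monus :: "real \<Rightarrow> real \<Rightarrow> real" (infixl "\<ominus>" 65) where
  "a \<ominus> b = max (a - b) 0"

(* In continuous logic the metric of a sort takes values in [0,1].  Diameter exactly 1 is not
   required here; it follows from d(0,1) = 1 in the models of the theories below. *)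
definition metric_sort :: "'a metric \<Rightarrow> bool" where
  "metric_sort m \<longleftrightarrow> mcomplete_of m \<and> (\<forall>x\<in>mspace m. \<forall>y\<in>mspace m. mdist m x y \<le> 1)"

definition has_modulus1 ::
  "'a metric \<Rightarrow> ('b \<Rightarrow> 'b \<Rightarrow> real) \<Rightarrow> ('a \<Rightarrow> 'b) \<Rightarrow> (real \<Rightarrow> real) \<Rightarrow> bool" where
  "has_modulus1 m e f \<Delta> \<longleftrightarrow>
     (\<forall>\<epsilon>>0. \<forall>x\<in>mspace m. \<forall>x'\<in>mspace m.
        mdist m x x' \<le> \<Delta> \<epsilon> \<longrightarrow> e (f x) (f x') \<le> \<epsilon>)"

definition has_modulus2 ::
  "'a metric \<Rightarrow> ('b \<Rightarrow> 'b \<Rightarrow> real) \<Rightarrow> ('a \<Rightarrow> 'a \<Rightarrow> 'b) \<Rightarrow> (real \<Rightarrow> real) \<Rightarrow> bool" where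
  "has_modulus2 m e f \<Delta> \<longleftrightarrow>
     (\<forall>\<epsilon>>0. \<forall>x\<in>mspace m. \<forall>x'\<in>mspace m. \<forall>y\<in>mspace m. \<forall>y'\<in>mspace m.
        mdist m x x' \<le> \<Delta> \<epsilon> \<and> mdist m y y' \<le> \<Delta> \<epsilon> \<longrightarrow> e (f x y) (f x' y') \<le> \<epsilon>)"


subsection \<open>The language of metric lattices\<close>

record 'a L_struct =
  L_met :: "'a metric"
  L_zero :: 'a
  L_one :: 'a
  L_plus :: "'a \<Rightarrow> 'a \<Rightarrow> 'a"

abbreviation L_sp :: "'a L_struct \<Rightarrow> 'a set" where
  "L_sp M \<equiv> mspace (L_met M)"

abbreviation L_d :: "'a L_struct \<Rightarrow> 'a \<Rightarrow> 'a \<Rightarrow> real" where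
  "L_d M \<equiv> mdist (L_met M)"

definition L_structure :: "'a L_struct \<Rightarrow> bool" where
  "L_structure M \<longleftrightarrow>
     metric_sort (L_met M) \<and> L_zero M \<in> L_sp M \<and> L_one M \<in> L_sp M \<and>
     (\<forall>x\<in>L_sp M. \<forall>y\<in>L_sp M. L_plus M x y \<in> L_sp M) \<and>
     (\<forall>x\<in>L_sp M. \<forall>x'\<in>L_sp M. \<forall>y\<in>L_sp M. \<forall>y'\<in>L_sp M.
        L_d M (L_plus M x y) (L_plus M x' y') \<le> L_d M x x' + L_d M y y')"

inductive L_term :: "('a L_struct \<Rightarrow> (nat \<Rightarrow> 'a) \<Rightarrow> 'a) \<Rightarrow> bool" where
  var: "L_term (\<lambda>M v. v i)"
| zero: "L_term (\<lambda>M v. L_zero M)"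
| one: "L_term (\<lambda>M v. L_one M)"
| plus: "L_term s \<Longrightarrow> L_term t \<Longrightarrow> L_term (\<lambda>M v. L_plus M (s M v) (t M v))"

(* Interpretations of formulas under valuations of the variables.  An n-ary continuous connective
   is a function of sequences, continuous for the product topology, used only on the sequences that
   vanish from n on; every continuous function on R^n (and, extended to R^n, every continuous
   function on a cube) is of this form. *)
inductive L_formula :: "('a L_struct \<Rightarrow> (nat \<Rightarrow> 'a) \<Rightarrow> real) \<Rightarrow> bool" where
  dist: "L_term s \<Longrightarrow> L_term t \<Longrightarrow> L_formula (\<lambda>M v. L_d M (s M v) (t M v))"
| conn: "continuous_on UNIV (u :: (nat \<Rightarrow> real) \<Rightarrow> real) \<Longrightarrow> (\<And>i. i < n \<Longrightarrow> L_formula (\<phi> i)) \<Longrightarrow>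
           L_formula (\<lambda>M v. u (\<lambda>i. if i < n then \<phi> i M v else 0))"
| sup: "L_formula \<phi> \<Longrightarrow> L_formula (\<lambda>M v. SUP a\<in>L_sp M. \<phi> M (v(i := a)))"
| inf: "L_formula \<phi> \<Longrightarrow> L_formula (\<lambda>M v. INF a\<in>L_sp M. \<phi> M (v(i := a)))"

(* A definable predicate is a limit of formulas, uniformly over all structures and valuations.
   The variables x, y, z are those with numbers 0, 1, 2. *)
definition L_definable3 :: "('a L_struct \<Rightarrow> 'a \<Rightarrow> 'a \<Rightarrow> 'a \<Rightarrow> real) \<Rightarrow> bool" where
  "L_definable3 P \<longleftrightarrow>
     (\<exists>\<phi>. (\<forall>n. L_formula (\<phi> n)) \<and>
          uniform_limit {(M, v). L_structure M \<and> range v \<subseteq> L_sp M}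
            (\<lambda>n (M, v). \<phi> n M v) (\<lambda>(M, v). P M (v 0) (v 1) (v 2)) sequentially)"

definition L_norm :: "'a L_struct \<Rightarrow> 'a \<Rightarrow> real" where
  "L_norm M x = L_d M x (L_zero M)"

definition L_d' :: "'a L_struct \<Rightarrow> 'a \<Rightarrow> 'a \<Rightarrow> real" where
  "L_d' M x y = L_d M (L_plus M x y) x + L_d M (L_plus M x y) y"

definition L_le :: "'a L_struct \<Rightarrow> 'a \<Rightarrow> 'a \<Rightarrow> bool" where
  "L_le M x y \<longleftrightarrow> L_plus M x y = y"

definition L_meet :: "'a L_struct \<Rightarrow> 'a \<Rightarrow> 'a \<Rightarrow> 'a" where
  "L_meet M x y =
     (THE z. z \<in> L_sp M \<and> L_le M z x \<and> L_le M z y \<and>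
             (\<forall>w\<in>L_sp M. L_le M w x \<and> L_le M w y \<longrightarrow> L_le M w z))"

definition T_ML :: "'a L_struct sentence set" where
  "T_ML =
    {\<lambda>M. \<bar>L_d M (L_zero M) (L_one M) - 1\<bar>,
     \<lambda>M. SUP x\<in>L_sp M. L_d M (L_plus M x (L_zero M)) x + L_d M (L_plus M x (L_one M)) (L_one M),
     \<lambda>M. SUP x\<in>L_sp M. L_d M (L_plus M x x) x,
     \<lambda>M. SUP x\<in>L_sp M. SUP y\<in>L_sp M. L_d M (L_plus M x y) (L_plus M y x),
     \<lambda>M. SUP x\<in>L_sp M. SUP y\<in>L_sp M. SUP z\<in>L_sp M.
           L_d M (L_plus M (L_plus M x y) z) (L_plus M x (L_plus M y z)),
     \<lambda>M. SUP x\<in>L_sp M. SUP y\<in>L_sp M. SUP z\<in>L_sp M.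
           L_d M (L_plus M x z) (L_plus M y z) \<ominus> L_d M x y,
     \<lambda>M. SUP x\<in>L_sp M. SUP y\<in>L_sp M. SUP z\<in>L_sp M.
           (L_d M x y + L_d M z (L_zero M)) \<ominus>
           (L_d M (L_plus M x y) (L_zero M) + L_d M (L_plus M x z) x + L_d M (L_plus M y z) y)}"

definition \<sigma>_mod :: "'a L_struct sentence" where
  "\<sigma>_mod M =
     (SUP x\<in>L_sp M. SUP y\<in>L_sp M. INF z\<in>L_sp M.
        max ((L_norm M x + L_norm M y) \<ominus> (L_norm M (L_plus M x y) + L_norm M z))
          (max (L_d M (L_plus M x z) x) (L_d M (L_plus M y z) y)))"

definition T_MML :: "'a L_struct sentence set" where
  "T_MML = T_ML \<union> {\<sigma>_mod}"

definition \<sigma>_dist :: "('a L_struct \<Rightarrow> 'a \<Rightarrow> 'a \<Rightarrow> 'a \<Rightarrow> real) \<Rightarrow> 'a L_struct sentence" where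
  "\<sigma>_dist \<phi>\<^sub>m M =
     (SUP x\<in>L_sp M. SUP y\<in>L_sp M. SUP z\<in>L_sp M. INF t\<in>L_sp M. INF w\<in>L_sp M.
        max (\<phi>\<^sub>m M x y t) (max (\<phi>\<^sub>m M x z w) (\<phi>\<^sub>m M x (L_plus M y z) (L_plus M t w))))"

definition \<sigma>_wcom :: "'a L_struct sentence" where
  "\<sigma>_wcom M = (SUP x\<in>L_sp M. INF y\<in>L_sp M. 1 - L_d M x y)"

definition \<sigma>_dd' :: "'a L_struct sentence" where
  "\<sigma>_dd' M = (SUP x\<in>L_sp M. SUP y\<in>L_sp M. \<bar>L_d M x y - L_d' M x y\<bar>)"

definition T_BML :: "('a L_struct \<Rightarrow> 'a \<Rightarrow> 'a \<Rightarrow> 'a \<Rightarrow> real) \<Rightarrow> 'a L_struct sentence set" where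
  "T_BML \<phi>\<^sub>m = T_MML \<union> {\<sigma>_dist \<phi>\<^sub>m, \<sigma>_wcom, \<sigma>_dd'}"


subsection \<open>The language of probability algebras\<close>

record 'a Lpr_struct =
  P_met :: "'a metric"
  P_mu :: "'a \<Rightarrow> real"
  P_cap :: "'a \<Rightarrow> 'a \<Rightarrow> 'a"
  P_cup :: "'a \<Rightarrow> 'a \<Rightarrow> 'a"
  P_compl :: "'a \<Rightarrow> 'a"
  P_zero :: 'a
  P_one :: 'a

abbreviation P_sp :: "'a Lpr_struct \<Rightarrow> 'a set" where
  "P_sp N \<equiv> mspace (P_met N)"

abbreviation P_d :: "'a Lpr_struct \<Rightarrow> 'a \<Rightarrow> 'a \<Rightarrow> real" where
  "P_d N \<equiv> mdist (P_met N)"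

definition Lpr_structure :: "'a Lpr_struct \<Rightarrow> bool" where
  "Lpr_structure N \<longleftrightarrow>
     metric_sort (P_met N) \<and> P_zero N \<in> P_sp N \<and> P_one N \<in> P_sp N \<and>
     (\<forall>x\<in>P_sp N. 0 \<le> P_mu N x \<and> P_mu N x \<le> 1) \<and>
     (\<forall>x\<in>P_sp N. P_compl N x \<in> P_sp N) \<and>
     (\<forall>x\<in>P_sp N. \<forall>y\<in>P_sp N. P_cap N x y \<in> P_sp N \<and> P_cup N x y \<in> P_sp N) \<and>
     has_modulus1 (P_met N) dist (P_mu N) (\<lambda>\<epsilon>. \<epsilon>) \<and>
     has_modulus1 (P_met N) (P_d N) (P_compl N) (\<lambda>\<epsilon>. \<epsilon>) \<and>
     has_modulus2 (P_met N) (P_d N) (P_cap N) (\<lambda>\<epsilon>. \<epsilon> / 2) \<and>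
     has_modulus2 (P_met N) (P_d N) (P_cup N) (\<lambda>\<epsilon>. \<epsilon> / 2)"

definition P_symdiff :: "'a Lpr_struct \<Rightarrow> 'a \<Rightarrow> 'a \<Rightarrow> 'a" where
  "P_symdiff N x y = P_cup N (P_cap N x (P_compl N y)) (P_cap N (P_compl N x) y)"

definition boolean_algebra_axioms :: "'a Lpr_struct sentence set" where
  "boolean_algebra_axioms =
    {\<lambda>N. SUP x\<in>P_sp N. SUP y\<in>P_sp N. P_d N (P_cup N x y) (P_cup N y x),
     \<lambda>N. SUP x\<in>P_sp N. SUP y\<in>P_sp N. P_d N (P_cap N x y) (P_cap N y x),
     \<lambda>N. SUP x\<in>P_sp N. SUP y\<in>P_sp N. SUP z\<in>P_sp N.
           P_d N (P_cup N x (P_cup N y z)) (P_cup N (P_cup N x y) z),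
     \<lambda>N. SUP x\<in>P_sp N. SUP y\<in>P_sp N. SUP z\<in>P_sp N.
           P_d N (P_cap N x (P_cap N y z)) (P_cap N (P_cap N x y) z),
     \<lambda>N. SUP x\<in>P_sp N. SUP y\<in>P_sp N. P_d N (P_cup N x (P_cap N x y)) x,
     \<lambda>N. SUP x\<in>P_sp N. SUP y\<in>P_sp N. P_d N (P_cap N x (P_cup N x y)) x,
     \<lambda>N. SUP x\<in>P_sp N. SUP y\<in>P_sp N. SUP z\<in>P_sp N.
           P_d N (P_cap N x (P_cup N y z)) (P_cup N (P_cap N x y) (P_cap N x z)),
     \<lambda>N. SUP x\<in>P_sp N. SUP y\<in>P_sp N. SUP z\<in>P_sp N.
           P_d N (P_cup N x (P_cap N y z)) (P_cap N (P_cup N x y) (P_cup N x z)),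
     \<lambda>N. SUP x\<in>P_sp N. P_d N (P_cup N x (P_zero N)) x,
     \<lambda>N. SUP x\<in>P_sp N. P_d N (P_cap N x (P_one N)) x,
     \<lambda>N. SUP x\<in>P_sp N. P_d N (P_cup N x (P_compl N x)) (P_one N),
     \<lambda>N. SUP x\<in>P_sp N. P_d N (P_cap N x (P_compl N x)) (P_zero N)}"

definition measure_axioms :: "'a Lpr_struct sentence set" where
  "measure_axioms =
    {\<lambda>N. P_mu N (P_zero N),
     \<lambda>N. \<bar>P_mu N (P_one N) - 1\<bar>,
     \<lambda>N. SUP x\<in>P_sp N. SUP y\<in>P_sp N. P_mu N (P_cap N x y) \<ominus> P_mu N x,
     \<lambda>N. SUP x\<in>P_sp N. SUP y\<in>P_sp N. P_mu N x \<ominus> P_mu N (P_cup N x y),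
     \<lambda>N. SUP x\<in>P_sp N. SUP y\<in>P_sp N.
           \<bar>(P_mu N x \<ominus> P_mu N (P_cap N x y)) - (P_mu N (P_cup N x y) \<ominus> P_mu N y)\<bar>}"

definition PR :: "'a Lpr_struct sentence set" where
  "PR = boolean_algebra_axioms \<union> measure_axioms \<union>
    {\<lambda>N. SUP x\<in>P_sp N. SUP y\<in>P_sp N. \<bar>P_d N x y - P_mu N (P_symdiff N x y)\<bar>}"

definition view_as_Lpr ::
  "'a L_struct \<Rightarrow> ('a \<Rightarrow> 'a \<Rightarrow> 'a) \<Rightarrow> ('a \<Rightarrow> 'a) \<Rightarrow> ('a \<Rightarrow> real) \<Rightarrow> 'a Lpr_struct" where
  "view_as_Lpr M cap compl \<mu> =
     \<lparr>P_met = L_met M, P_mu = \<mu>, P_cap = cap, P_cup = L_plus M, P_compl = compl,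
      P_zero = L_zero M, P_one = L_one M\<rparr>"

end

theory Submission
  imports Defs
begin

text \<open>
  Both theories describe, up to the choice of language, a Boolean algebra with a normalised
  measure \<open>\<mu>\<close> whose metric is \<open>d x y = \<mu> (x \<Delta> y)\<close>.  The measure is recovered from the metric as
  the norm \<open>d x 0\<close>.

  From the lattice axioms to a probability algebra.  The last axiom of metric lattices forces
  \<open>d y x = |y| - |x|\<close> whenever \<open>x \<le> y\<close> (\<open>d_comparable\<close>), so \<open>d = d'\<close> determines the metric from
  the norm and the join: \<open>d x y = 2 |x + y| - |x| - |y|\<close> (\<open>d_formula\<close>).  The remaining existence
  axioms hold only up to an error, since they are infima, and completeness has to turn them into
  exact statements (\<open>ex_limit_of_approximations\<close>).  An element that is below \<open>x\<close> and \<open>y\<close> up to a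
  small error has norm at most \<open>|x| + |y| - |x + y|\<close> up to a small error, and the modularity
  axiom says that this bound is almost attained.  The join of two elements that almost attain it
  is again almost a lower bound, so it cannot have a much larger norm, and hence the two are close
  to each other.  Their limit is the meet, and it satisfies \<open>|x| + |y| = |x + y| + |xy|\<close>
  (\<open>meet_properties\<close>).  Likewise, elements \<open>y\<close> with \<open>d x y\<close> close to \<open>1\<close> are approximate
  complements of \<open>x\<close>, and distributivity shows, just as in the uniqueness proof for complements,
  that they are close to each other (\<open>approx_compls_close\<close>); their limit is a complement.  This is
  a Boolean algebra on which the norm is a modular measure.  Complementation is an isometry, and
  so the meet inherits the uniform continuity of the join through De Morgan's law.

  From a probability algebra to the lattice axioms.  Here \<open>d x y = \<mu> (x \<squnion> y) - \<mu> (x \<sqinter> y)\<close>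
  (\<open>mu_symdiff\<close>), and all infima are attained: at the meet, at the two meets, and at the
  complement.  The last axiom of metric lattices becomes
  \<open>\<mu> (z \<sqinter> x) + \<mu> (z \<sqinter> y) \<le> \<mu> z + \<mu> (x \<sqinter> y)\<close> (\<open>mu_cap_pair_le\<close>).

  Being a model of either theory is first translated into statements without suprema and infima
  (\<open>models_T_BML_iff\<close>, \<open>models_PR_iff\<close>).  All the functions concerned are nonnegative and bounded,
  so a supremum vanishes exactly when the function does.
\<close>

section \<open>Suprema and infima with value zero\<close>

lemma SUP_nonneg_bounded:
  fixes f :: "'b \<Rightarrow> real"
  assumes "S \<noteq> {}" and "\<And>x. x \<in> S \<Longrightarrow> 0 \<le> f x \<and> f x \<le> B"
  shows "0 \<le> (SUP x\<in>S. f x) \<and> (SUP x\<in>S. f x) \<le> B"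
proof -
  obtain a where a: "a \<in> S" using assms(1) by blast
  have "bdd_above (f ` S)" using assms(2) by (auto intro!: bdd_aboveI2)
  then have "f a \<le> (SUP x\<in>S. f x)" using a by (rule cSUP_upper2) simp
  moreover have "(SUP x\<in>S. f x) \<le> B" using assms by (intro cSUP_least) auto
  ultimately show ?thesis using assms(2)[OF a] by linarith
qed

lemma INF_nonneg_bounded:
  fixes f :: "'b \<Rightarrow> real"
  assumes "S \<noteq> {}" and "\<And>x. x \<in> S \<Longrightarrow> 0 \<le> f x \<and> f x \<le> B"
  shows "0 \<le> (INF x\<in>S. f x) \<and> (INF x\<in>S. f x) \<le> B"
proof -
  obtain a where a: "a \<in> S" using assms(1) by blast
  have "bdd_below (f ` S)" using assms(2) by (auto intro!: bdd_belowI2)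
  then have "(INF x\<in>S. f x) \<le> f a" using a by (rule cINF_lower2) simp
  moreover have "0 \<le> (INF x\<in>S. f x)" using assms by (intro cINF_greatest) auto
  ultimately show ?thesis using assms(2)[OF a] by linarith
qed

lemma SUP_eq_0_iff:
  fixes f :: "'b \<Rightarrow> real"
  assumes "S \<noteq> {}" and "\<And>x. x \<in> S \<Longrightarrow> 0 \<le> f x \<and> f x \<le> B"
  shows "(SUP x\<in>S. f x) = 0 \<longleftrightarrow> (\<forall>x\<in>S. f x = 0)"
proof
  assume *: "(SUP x\<in>S. f x) = 0"
  have "bdd_above (f ` S)" using assms(2) by (auto intro!: bdd_aboveI2)
  then have "f x \<le> 0" if "x \<in> S" for x using cSUP_upper[OF that] * by metis
  then show "\<forall>x\<in>S. f x = 0" using assms(2) by force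
next
  assume "\<forall>x\<in>S. f x = 0"
  then have "(SUP x\<in>S. f x) = (SUP x\<in>S. 0)" by (intro SUP_cong) auto
  then show "(SUP x\<in>S. f x) = 0" using assms(1) by simp
qed

lemma INF_eq_0_iff:
  fixes f :: "'b \<Rightarrow> real"
  assumes "S \<noteq> {}" and "\<And>x. x \<in> S \<Longrightarrow> 0 \<le> f x \<and> f x \<le> B"
  shows "(INF x\<in>S. f x) = 0 \<longleftrightarrow> (\<forall>\<epsilon>>0. \<exists>x\<in>S. f x < \<epsilon>)"
proof -
  have "bdd_below (f ` S)" using assms(2) by (auto intro!: bdd_belowI2)
  then have less: "(INF x\<in>S. f x) < \<epsilon> \<longleftrightarrow> (\<exists>x\<in>S. f x < \<epsilon>)" for \<epsilon>
    using assms(1) by (simp add: cINF_less_iff)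
  have nonneg: "0 \<le> (INF x\<in>S. f x)" using assms by (intro cINF_greatest) auto
  have "(INF x\<in>S. f x) = 0 \<longleftrightarrow> (\<forall>\<epsilon>>0. (INF x\<in>S. f x) < \<epsilon>)"
    using nonneg by (metis less_irrefl order_le_less)
  then show ?thesis unfolding less .
qed

lemma SUP2_eq_0_iff:
  fixes f :: "'b \<Rightarrow> 'b \<Rightarrow> real"
  assumes "S \<noteq> {}" and "\<And>x y. x \<in> S \<Longrightarrow> y \<in> S \<Longrightarrow> 0 \<le> f x y \<and> f x y \<le> B"
  shows "(SUP x\<in>S. SUP y\<in>S. f x y) = 0 \<longleftrightarrow> (\<forall>x\<in>S. \<forall>y\<in>S. f x y = 0)"
proof -
  have "(SUP x\<in>S. SUP y\<in>S. f x y) = 0 \<longleftrightarrow> (\<forall>x\<in>S. (SUP y\<in>S. f x y) = 0)"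
    by (intro SUP_eq_0_iff[where B = B] SUP_nonneg_bounded assms)
  also have "\<dots> \<longleftrightarrow> (\<forall>x\<in>S. \<forall>y\<in>S. f x y = 0)"
    by (intro ball_cong refl SUP_eq_0_iff[where B = B] assms)
  finally show ?thesis .
qed

lemma SUP3_eq_0_iff:
  fixes f :: "'b \<Rightarrow> 'b \<Rightarrow> 'b \<Rightarrow> real"
  assumes "S \<noteq> {}"
    and "\<And>x y z. x \<in> S \<Longrightarrow> y \<in> S \<Longrightarrow> z \<in> S \<Longrightarrow> 0 \<le> f x y z \<and> f x y z \<le> B"
  shows "(SUP x\<in>S. SUP y\<in>S. SUP z\<in>S. f x y z) = 0 \<longleftrightarrow>
           (\<forall>x\<in>S. \<forall>y\<in>S. \<forall>z\<in>S. f x y z = 0)"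
proof -
  have "(SUP x\<in>S. SUP y\<in>S. SUP z\<in>S. f x y z) = 0 \<longleftrightarrow>
      (\<forall>x\<in>S. \<forall>y\<in>S. (SUP z\<in>S. f x y z) = 0)"
    by (intro SUP2_eq_0_iff[where B = B] SUP_nonneg_bounded assms)
  also have "\<dots> \<longleftrightarrow> (\<forall>x\<in>S. \<forall>y\<in>S. \<forall>z\<in>S. f x y z = 0)"
    by (intro ball_cong refl SUP_eq_0_iff[where B = B] assms)
  finally show ?thesis .
qed


section \<open>Boolean algebras on a carrier set\<close>

locale carrier_boolean_algebra =
  fixes X :: "'a set"
    and cap :: "'a \<Rightarrow> 'a \<Rightarrow> 'a" (infixl "\<sqinter>" 70)
    and cup :: "'a \<Rightarrow> 'a \<Rightarrow> 'a" (infixl "\<squnion>" 65)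
    and compl :: "'a \<Rightarrow> 'a"
    and zero :: 'a ("\<zero>")
    and one :: 'a ("\<one>")
  assumes zero_closed [simp]: "\<zero> \<in> X"
    and one_closed [simp]: "\<one> \<in> X"
    and cap_closed [simp]: "x \<in> X \<Longrightarrow> y \<in> X \<Longrightarrow> x \<sqinter> y \<in> X"
    and cup_closed [simp]: "x \<in> X \<Longrightarrow> y \<in> X \<Longrightarrow> x \<squnion> y \<in> X"
    and compl_closed [simp]: "x \<in> X \<Longrightarrow> compl x \<in> X"
    and cup_commute: "x \<in> X \<Longrightarrow> y \<in> X \<Longrightarrow> x \<squnion> y = y \<squnion> x"
    and cap_commute: "x \<in> X \<Longrightarrow> y \<in> X \<Longrightarrow> x \<sqinter> y = y \<sqinter> x"
    and cup_assoc: "x \<in> X \<Longrightarrow> y \<in> X \<Longrightarrow> z \<in> X \<Longrightarrow> x \<squnion> (y \<squnion> z) = (x \<squnion> y) \<squnion> z"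
    and cap_assoc: "x \<in> X \<Longrightarrow> y \<in> X \<Longrightarrow> z \<in> X \<Longrightarrow> x \<sqinter> (y \<sqinter> z) = (x \<sqinter> y) \<sqinter> z"
    and cup_absorb: "x \<in> X \<Longrightarrow> y \<in> X \<Longrightarrow> x \<squnion> (x \<sqinter> y) = x"
    and cap_absorb: "x \<in> X \<Longrightarrow> y \<in> X \<Longrightarrow> x \<sqinter> (x \<squnion> y) = x"
    and cap_cup_distrib:
      "x \<in> X \<Longrightarrow> y \<in> X \<Longrightarrow> z \<in> X \<Longrightarrow> x \<sqinter> (y \<squnion> z) = (x \<sqinter> y) \<squnion> (x \<sqinter> z)"
    and cup_cap_distrib:
      "x \<in> X \<Longrightarrow> y \<in> X \<Longrightarrow> z \<in> X \<Longrightarrow> x \<squnion> (y \<sqinter> z) = (x \<squnion> y) \<sqinter> (x \<squnion> z)"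
    and cup_zero: "x \<in> X \<Longrightarrow> x \<squnion> \<zero> = x"
    and cap_one: "x \<in> X \<Longrightarrow> x \<sqinter> \<one> = x"
    and cup_compl: "x \<in> X \<Longrightarrow> x \<squnion> compl x = \<one>"
    and cap_compl: "x \<in> X \<Longrightarrow> x \<sqinter> compl x = \<zero>"
begin

lemma cup_idem: "x \<in> X \<Longrightarrow> x \<squnion> x = x"
  by (metis cap_one cup_absorb one_closed)

lemma cup_one: "x \<in> X \<Longrightarrow> x \<squnion> \<one> = \<one>"
  by (metis cap_commute cap_one cup_absorb cup_commute one_closed)

lemma cap_zero: "x \<in> X \<Longrightarrow> x \<sqinter> \<zero> = \<zero>"
  by (metis cap_absorb cap_commute cup_commute cup_zero zero_closed)

lemma cap_cap_swap:
  assumes "x \<in> X" "y \<in> X" "z \<in> X" "w \<in> X"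
  shows "(x \<sqinter> y) \<sqinter> (z \<sqinter> w) = (x \<sqinter> z) \<sqinter> (y \<sqinter> w)"
proof -
  have "y \<sqinter> (z \<sqinter> w) = z \<sqinter> (y \<sqinter> w)"
    using assms by (simp add: cap_assoc cap_commute[of y z])
  then have "x \<sqinter> (y \<sqinter> (z \<sqinter> w)) = x \<sqinter> (z \<sqinter> (y \<sqinter> w))" by simp
  then show ?thesis using assms cap_assoc[of x y "z \<sqinter> w"] cap_assoc[of x z "y \<sqinter> w"] by simp
qed

lemma cap_idem: "x \<in> X \<Longrightarrow> x \<sqinter> x = x"
  using cap_absorb[of x \<zero>] by (simp add: cup_zero)

lemma cap_greatest:
  assumes "x \<in> X" "y \<in> X" "w \<in> X" "w \<squnion> x = x" "w \<squnion> y = y"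
  shows "w \<squnion> (x \<sqinter> y) = x \<sqinter> y"
  using assms by (simp add: cup_cap_distrib)

text \<open>Distributivity makes complements unique, which is used to recognise the complement of a
  meet below.\<close>

lemma compl_unique:
  assumes "x \<in> X" "y \<in> X" "x \<squnion> y = \<one>" "x \<sqinter> y = \<zero>"
  shows "y = compl x"
proof -
  have "y = y \<sqinter> (x \<squnion> compl x)" using assms by (simp add: cup_compl cap_one)
  also have "\<dots> = \<zero> \<squnion> (y \<sqinter> compl x)"
    using assms by (simp add: cap_cup_distrib cap_commute[of y x])
  also have "\<dots> = (x \<sqinter> compl x) \<squnion> (y \<sqinter> compl x)" using assms by (simp add: cap_compl)
  also have "\<dots> = compl x \<sqinter> (x \<squnion> y)"
    using assms(1,2) cap_cup_distrib[of "compl x" x y]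
      cap_commute[of x "compl x"] cap_commute[of y "compl x"] by simp
  also have "\<dots> = compl x" using assms by (simp add: cap_one)
  finally show ?thesis .
qed

lemma compl_cap:
  assumes x: "x \<in> X" and y: "y \<in> X"
  shows "compl (x \<sqinter> y) = compl x \<squnion> compl y"
proof (rule compl_unique[symmetric])
  have "(compl x \<squnion> compl y) \<squnion> (x \<sqinter> y) =
      ((compl x \<squnion> compl y) \<squnion> x) \<sqinter> ((compl x \<squnion> compl y) \<squnion> y)"
    using x y by (simp add: cup_cap_distrib)
  also have "(compl x \<squnion> compl y) \<squnion> x = compl y \<squnion> (x \<squnion> compl x)"
    using x y by (metis compl_closed cup_assoc cup_commute)
  also have "(compl x \<squnion> compl y) \<squnion> y = compl x \<squnion> (y \<squnion> compl y)"
    using x y by (metis compl_closed cup_assoc cup_commute)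
  finally show "(x \<sqinter> y) \<squnion> (compl x \<squnion> compl y) = \<one>"
    using x y cup_commute[of "x \<sqinter> y" "compl x \<squnion> compl y"]
    by (simp add: cup_compl cup_one cap_one)
  have 1: "(x \<sqinter> y) \<sqinter> compl x = y \<sqinter> (x \<sqinter> compl x)"
    using x y by (metis compl_closed cap_assoc cap_commute)
  have 2: "(x \<sqinter> y) \<sqinter> compl y = x \<sqinter> (y \<sqinter> compl y)"
    using x y by (simp add: cap_assoc)
  show "(x \<sqinter> y) \<sqinter> (compl x \<squnion> compl y) = \<zero>"
    using x y by (simp add: cap_cup_distrib 1 2 cap_compl cap_zero cup_zero)
qed (use x y in auto)

end

locale probability_valuation = carrier_boolean_algebra +
  fixes \<mu> :: "'a \<Rightarrow> real"
  assumes mu_zero: "\<mu> \<zero> = 0"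
    and mu_one: "\<mu> \<one> = 1"
    and mu_nonneg: "x \<in> X \<Longrightarrow> 0 \<le> \<mu> x"
    and mu_modular: "x \<in> X \<Longrightarrow> y \<in> X \<Longrightarrow> \<mu> x + \<mu> y = \<mu> (x \<squnion> y) + \<mu> (x \<sqinter> y)"
begin

lemma mu_split:
  assumes x: "x \<in> X" and y: "y \<in> X"
  shows "\<mu> x = \<mu> (x \<sqinter> y) + \<mu> (x \<sqinter> compl y)"
proof -
  have "(x \<sqinter> y) \<sqinter> (x \<sqinter> compl y) = (x \<sqinter> x) \<sqinter> (y \<sqinter> compl y)"
    using x y by (simp add: cap_cap_swap)
  then have 1: "(x \<sqinter> y) \<sqinter> (x \<sqinter> compl y) = \<zero>" using x y by (simp add: cap_compl cap_zero)
  have 2: "(x \<sqinter> y) \<squnion> (x \<sqinter> compl y) = x"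
    using x y cap_cup_distrib[of x y "compl y"] by (simp add: cup_compl cap_one)
  show ?thesis using mu_modular[of "x \<sqinter> y" "x \<sqinter> compl y"] x y by (simp add: 1 2 mu_zero)
qed

lemma mu_cap_le: "x \<in> X \<Longrightarrow> y \<in> X \<Longrightarrow> \<mu> (x \<sqinter> y) \<le> \<mu> x"
  using mu_split[of x y] mu_nonneg[of "x \<sqinter> compl y"] by simp

lemma mu_le_cup: "x \<in> X \<Longrightarrow> y \<in> X \<Longrightarrow> \<mu> x \<le> \<mu> (x \<squnion> y)"
  using mu_cap_le[of "x \<squnion> y" x] cap_commute[of "x \<squnion> y" x] by (simp add: cap_absorb)

text \<open>The two halves of the symmetric difference are disjoint and have measure
  \<open>\<mu> x - \<mu> (x \<sqinter> y)\<close> and \<open>\<mu> y - \<mu> (x \<sqinter> y)\<close>.  The right-hand side no longer mentions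
  complements, so it can be compared with a lattice metric.\<close>

lemma mu_symdiff:
  assumes x: "x \<in> X" and y: "y \<in> X"
  shows "\<mu> ((x \<sqinter> compl y) \<squnion> (compl x \<sqinter> y)) = \<mu> (x \<squnion> y) - \<mu> (x \<sqinter> y)"
proof -
  have "(x \<sqinter> compl y) \<sqinter> (compl x \<sqinter> y) = (x \<sqinter> compl x) \<sqinter> (y \<sqinter> compl y)"
    using x y cap_cap_swap[of x "compl y" "compl x" y] cap_commute[of "compl y" y] by simp
  then have "(x \<sqinter> compl y) \<sqinter> (compl x \<sqinter> y) = \<zero>" using x y by (simp add: cap_compl cap_zero)
  then have "\<mu> ((x \<sqinter> compl y) \<squnion> (compl x \<sqinter> y)) = \<mu> (x \<sqinter> compl y) + \<mu> (compl x \<sqinter> y)"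
    using mu_modular[of "x \<sqinter> compl y" "compl x \<sqinter> y"] x y by (simp add: mu_zero)
  also have "\<dots> = (\<mu> x - \<mu> (x \<sqinter> y)) + (\<mu> y - \<mu> (x \<sqinter> y))"
    using mu_split[OF x y] mu_split[OF y x] cap_commute[OF x y] cap_commute[of "compl x" y] x y
    by simp
  also have "\<dots> = \<mu> (x \<squnion> y) - \<mu> (x \<sqinter> y)" using mu_modular[OF x y] by simp
  finally show ?thesis .
qed

text \<open>This is what the last axiom of metric lattices says once distances are replaced by
  measures.\<close>

lemma mu_cap_pair_le:
  assumes x: "x \<in> X" and y: "y \<in> X" and z: "z \<in> X"
  shows "\<mu> (z \<sqinter> x) + \<mu> (z \<sqinter> y) \<le> \<mu> z + \<mu> (x \<sqinter> y)"
proof -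
  have 1: "(z \<sqinter> x) \<squnion> (z \<sqinter> y) = z \<sqinter> (x \<squnion> y)" using x y z by (simp add: cap_cup_distrib)
  have "(z \<sqinter> x) \<sqinter> (z \<sqinter> y) = (x \<sqinter> y) \<sqinter> z"
    using x y z by (simp add: cap_cap_swap cap_idem cap_commute[of z])
  then have 2: "\<mu> ((z \<sqinter> x) \<sqinter> (z \<sqinter> y)) \<le> \<mu> (x \<sqinter> y)" using x y z by (simp add: mu_cap_le)
  show ?thesis
    using mu_modular[of "z \<sqinter> x" "z \<sqinter> y"] mu_cap_le[of z "x \<squnion> y"] x y z 1 2 by simp
qed

end


section \<open>Limits of approximate solutions\<close>

context Metric_space begin

text \<open>A condition \<open>P \<epsilon>\<close> describes what it means to solve some problem up to \<open>\<epsilon>\<close>.  If any two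
  approximate solutions are close, with a bound that is linear in their errors, then the solutions
  up to \<open>1/n\<close> form a Cauchy sequence.  Its limit is approached by solutions of arbitrarily small
  error, and a continuity argument then makes it an exact solution.  Meets and complements are both
  found in this way, because the theories speak of them through infima only.\<close>

lemma ex_limit_of_approximations:
  assumes "mcomplete"
    and ex: "\<And>\<epsilon>. \<epsilon> > 0 \<Longrightarrow> \<exists>z\<in>M. P \<epsilon> z"
    and close: "\<And>a b z w. a > 0 \<Longrightarrow> b > 0 \<Longrightarrow> z \<in> M \<Longrightarrow> w \<in> M \<Longrightarrow> P a z \<Longrightarrow> P b w \<Longrightarrow>
        d z w \<le> C * (a + b)"
  obtains z where "z \<in> M" and "\<And>\<epsilon>. \<epsilon> > 0 \<Longrightarrow> \<exists>w\<in>M. \<exists>a. 0 < a \<and> a < \<epsilon> \<and> P a w \<and> d w z < \<epsilon>"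
proof -
  define a where "a n = inverse (real (Suc n))" for n
  have a_pos: "a n > 0" for n by (simp add: a_def)
  have a_lim: "a \<longlonglongrightarrow> 0" unfolding a_def by (rule LIMSEQ_inverse_real_of_nat)
  have a_mono: "a n \<le> a m" if "m \<le> n" for m n using that by (simp add: a_def field_simps)
  have "\<exists>z. \<forall>n. z n \<in> M \<and> P (a n) (z n)"
    by (intro choice allI) (use ex[OF a_pos] in blast)
  then obtain z where z: "\<And>n. z n \<in> M" and Pz: "\<And>n. P (a n) (z n)" by blast
  have "MCauchy z"
    unfolding MCauchy_def
  proof (intro conjI allI impI)
    show "range z \<subseteq> M" using z by auto
    fix \<epsilon> :: real assume \<epsilon>: "\<epsilon> > 0"
    have "(\<lambda>n. \<bar>C\<bar> * (2 * a n)) \<longlonglongrightarrow> \<bar>C\<bar> * (2 * 0)" by (intro tendsto_intros a_lim)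
    then have "eventually (\<lambda>n. \<bar>C\<bar> * (2 * a n) < \<epsilon>) sequentially"
      using \<epsilon> by (intro order_tendstoD(2)[where a = \<epsilon>]) auto
    then obtain N where N: "\<bar>C\<bar> * (2 * a N) < \<epsilon>" by (auto simp: eventually_sequentially)
    have "d (z n) (z n') < \<epsilon>" if "N \<le> n" "N \<le> n'" for n n'
    proof -
      have "d (z n) (z n') \<le> C * (a n + a n')" by (intro close a_pos z Pz)
      also have "\<dots> \<le> \<bar>C\<bar> * (a n + a n')" using a_pos[of n] a_pos[of n'] by (intro mult_right_mono) auto
      also have "\<dots> \<le> \<bar>C\<bar> * (2 * a N)"
        using a_mono[OF that(1)] a_mono[OF that(2)] by (intro mult_left_mono) auto
      finally show ?thesis using N by simp
    qed
    then show "\<exists>N. \<forall>n n'. N \<le> n \<longrightarrow> N \<le> n' \<longrightarrow> d (z n) (z n') < \<epsilon>" by blast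
  qed
  then obtain l where l: "limitin mtopology z l sequentially"
    using assms(1) by (auto simp: mcomplete_def)
  show thesis
  proof
    show "l \<in> M" using l by (rule limitin_mspace)
    fix \<epsilon> :: real assume \<epsilon>: "\<epsilon> > 0"
    have "eventually (\<lambda>n. z n \<in> M \<and> d (z n) l < \<epsilon>) sequentially"
      using l \<epsilon> by (auto simp: limitin_metric)
    moreover have "eventually (\<lambda>n. a n < \<epsilon>) sequentially"
      using order_tendstoD(2)[OF a_lim \<epsilon>] .
    ultimately have "eventually (\<lambda>n. (z n \<in> M \<and> d (z n) l < \<epsilon>) \<and> a n < \<epsilon>) sequentially"
      by (rule eventually_conj)
    then obtain n where "z n \<in> M" "d (z n) l < \<epsilon>" "a n < \<epsilon>"
      by (auto simp: eventually_sequentially)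
    then show "\<exists>w\<in>M. \<exists>a. 0 < a \<and> a < \<epsilon> \<and> P a w \<and> d w l < \<epsilon>" using a_pos Pz by blast
  qed
qed

end


section \<open>Modular metric lattices\<close>

text \<open>The content of \<open>T_MML\<close> together with \<open>d = d'\<close>, with all suprema removed.  Only
  \<open>approx_meet\<close> still has an error term, because it comes from an infimum.\<close>

locale modular_metric_lattice = Metric_space X d for X :: "'a set" and d +
  fixes join :: "'a \<Rightarrow> 'a \<Rightarrow> 'a" (infixl "\<squnion>" 65)
    and zero :: 'a ("\<zero>")
    and one :: 'a ("\<one>")
  assumes complete: "mcomplete"
    and zero_closed [simp]: "\<zero> \<in> X"
    and one_closed [simp]: "\<one> \<in> X"
    and join_closed [simp]: "x \<in> X \<Longrightarrow> y \<in> X \<Longrightarrow> x \<squnion> y \<in> X"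
    and d_zero_one: "d \<zero> \<one> = 1"
    and join_zero: "x \<in> X \<Longrightarrow> x \<squnion> \<zero> = x"
    and join_one: "x \<in> X \<Longrightarrow> x \<squnion> \<one> = \<one>"
    and join_idem: "x \<in> X \<Longrightarrow> x \<squnion> x = x"
    and join_commute: "x \<in> X \<Longrightarrow> y \<in> X \<Longrightarrow> x \<squnion> y = y \<squnion> x"
    and join_assoc: "x \<in> X \<Longrightarrow> y \<in> X \<Longrightarrow> z \<in> X \<Longrightarrow> (x \<squnion> y) \<squnion> z = x \<squnion> (y \<squnion> z)"
    and join_contract: "x \<in> X \<Longrightarrow> y \<in> X \<Longrightarrow> z \<in> X \<Longrightarrow> d (x \<squnion> z) (y \<squnion> z) \<le> d x y"
    and near_lower_bound: "x \<in> X \<Longrightarrow> y \<in> X \<Longrightarrow> z \<in> X \<Longrightarrow>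
      d x y + d z \<zero> \<le> d (x \<squnion> y) \<zero> + d (x \<squnion> z) x + d (y \<squnion> z) y"
    and approx_meet: "x \<in> X \<Longrightarrow> y \<in> X \<Longrightarrow> \<epsilon> > 0 \<Longrightarrow>
      \<exists>z\<in>X. d x \<zero> + d y \<zero> < d (x \<squnion> y) \<zero> + d z \<zero> + \<epsilon> \<and> d (x \<squnion> z) x < \<epsilon> \<and> d (y \<squnion> z) y < \<epsilon>"
    and d_eq_d': "x \<in> X \<Longrightarrow> y \<in> X \<Longrightarrow> d x y = d (x \<squnion> y) x + d (x \<squnion> y) y"
begin

abbreviation nrm :: "'a \<Rightarrow> real" where "nrm x \<equiv> d x \<zero>"

abbreviation le :: "'a \<Rightarrow> 'a \<Rightarrow> bool" (infix "\<sqsubseteq>" 50) where "x \<sqsubseteq> y \<equiv> x \<squnion> y = y"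

lemma le_join: "x \<in> X \<Longrightarrow> y \<in> X \<Longrightarrow> x \<sqsubseteq> x \<squnion> y"
  by (metis join_assoc join_idem)

text \<open>One inequality is \<open>near_lower_bound\<close> with \<open>x\<close> itself as the lower bound of \<open>x\<close> and \<open>y\<close>;
  the other is the triangle inequality.\<close>

lemma d_comparable:
  assumes x: "x \<in> X" and y: "y \<in> X" and "x \<sqsubseteq> y"
  shows "d y x = nrm y - nrm x"
proof -
  have "d x y + nrm x \<le> nrm y"
    using near_lower_bound[of x y x] assms by (simp add: join_idem join_commute[of y x])
  moreover have "nrm y \<le> d y x + nrm x" using x y by (intro triangle) auto
  ultimately show ?thesis by (simp add: commute)
qed

lemma d_join: "x \<in> X \<Longrightarrow> y \<in> X \<Longrightarrow> d (x \<squnion> y) x = nrm (x \<squnion> y) - nrm x"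
  by (simp add: d_comparable le_join)

lemma d_formula: "x \<in> X \<Longrightarrow> y \<in> X \<Longrightarrow> d x y = 2 * nrm (x \<squnion> y) - nrm x - nrm y"
  using d_join[of x y] d_join[of y x] d_eq_d'[of x y] by (simp add: join_commute[of y x])

lemma nrm_mono: "x \<in> X \<Longrightarrow> y \<in> X \<Longrightarrow> x \<sqsubseteq> y \<Longrightarrow> nrm x \<le> nrm y"
  using d_comparable[of x y] nonneg[of y x] by simp

lemma nrm_one: "nrm \<one> = 1"
  using d_zero_one by (simp add: commute)

lemma nrm_le_1: "x \<in> X \<Longrightarrow> nrm x \<le> 1"
  using nrm_mono[of x \<one>] by (simp add: join_one nrm_one)

lemma nrm_eq_1: "x \<in> X \<Longrightarrow> nrm x = 1 \<Longrightarrow> x = \<one>"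
  using d_comparable[of x \<one>] by (simp add: nrm_one join_one)

lemma nrm_diff_le: "x \<in> X \<Longrightarrow> y \<in> X \<Longrightarrow> \<bar>nrm x - nrm y\<bar> \<le> d x y"
  using triangle[of x y \<zero>] triangle[of y x \<zero>] commute[of x y] by simp

lemma join_nonexpansive:
  assumes "x \<in> X" "x' \<in> X" "y \<in> X" "y' \<in> X"
  shows "d (x \<squnion> y) (x' \<squnion> y') \<le> d x x' + d y y'"
proof -
  have "d (x \<squnion> y) (x' \<squnion> y') \<le> d (x \<squnion> y) (x' \<squnion> y) + d (x' \<squnion> y) (x' \<squnion> y')"
    using assms by (intro triangle) auto
  also have "d (x \<squnion> y) (x' \<squnion> y) \<le> d x x'" using assms by (intro join_contract) auto
  also have "d (x' \<squnion> y) (x' \<squnion> y') \<le> d y y'"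
    using join_contract[of y y' x'] assms by (simp add: join_commute)
  finally show ?thesis by simp
qed

text \<open>The two distances on the right measure how far \<open>z\<close> is from being a lower bound of \<open>x\<close> and
  \<open>y\<close>.  Hence the norm of a true lower bound is at most \<open>|x| + |y| - |x + y|\<close>, which will be the
  norm of the meet.\<close>

lemma nrm_le_near:
  assumes x: "x \<in> X" and y: "y \<in> X" and z: "z \<in> X"
  shows "nrm z \<le> nrm x + nrm y - nrm (x \<squnion> y) + d (x \<squnion> z) x + d (y \<squnion> z) y"
  using near_lower_bound[OF x y z] d_formula[OF x y] by simp

lemma near_lower_bound_join:
  assumes x: "x \<in> X" and z: "z \<in> X" and w: "w \<in> X"
  shows "d (x \<squnion> (z \<squnion> w)) x \<le> d (x \<squnion> z) x + d (x \<squnion> w) x"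
proof -
  have "d (x \<squnion> (z \<squnion> w)) x \<le> d ((x \<squnion> z) \<squnion> w) (x \<squnion> w) + d (x \<squnion> w) x"
    using triangle[of "x \<squnion> (z \<squnion> w)" "x \<squnion> w" x] x z w by (simp add: join_assoc)
  moreover have "d ((x \<squnion> z) \<squnion> w) (x \<squnion> w) \<le> d (x \<squnion> z) x"
    using x z w by (intro join_contract) auto
  ultimately show ?thesis by simp
qed

text \<open>The join \<open>z \<squnion> w\<close> is almost a lower bound too, so its norm exceeds those of \<open>z\<close> and \<open>w\<close> by
  little, and \<open>d_formula\<close> then bounds the distance of \<open>z\<close> and \<open>w\<close>.  The constant \<open>5\<close> is twice the
  error \<open>2 (a + b)\<close> of the join plus the errors \<open>a + b\<close> of \<open>z\<close> and \<open>w\<close>.\<close>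

lemma approx_meets_close:
  assumes x: "x \<in> X" and y: "y \<in> X" and z: "z \<in> X" and w: "w \<in> X"
    and "d (x \<squnion> z) x \<le> a" "d (y \<squnion> z) y \<le> a" "nrm x + nrm y \<le> nrm (x \<squnion> y) + nrm z + a"
    and "d (x \<squnion> w) x \<le> b" "d (y \<squnion> w) y \<le> b" "nrm x + nrm y \<le> nrm (x \<squnion> y) + nrm w + b"
  shows "d z w \<le> 5 * (a + b)"
proof -
  have "nrm (z \<squnion> w) \<le> nrm x + nrm y - nrm (x \<squnion> y) + 2 * (a + b)"
    using nrm_le_near[OF x y, of "z \<squnion> w"] near_lower_bound_join[OF x z w]
      near_lower_bound_join[OF y z w] assms by simp
  then show ?thesis using d_formula[OF z w] assms by simp
qed

lemma ex_meet:
  assumes x: "x \<in> X" and y: "y \<in> X"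
  obtains z where "z \<in> X" "z \<sqsubseteq> x" "z \<sqsubseteq> y" "nrm x + nrm y = nrm (x \<squnion> y) + nrm z"
proof -
  let ?P = "\<lambda>\<epsilon> z. d (x \<squnion> z) x < \<epsilon> \<and> d (y \<squnion> z) y < \<epsilon> \<and> nrm x + nrm y < nrm (x \<squnion> y) + nrm z + \<epsilon>"
  obtain z where z: "z \<in> X"
    and lim: "\<And>\<epsilon>. \<epsilon> > 0 \<Longrightarrow> \<exists>w\<in>X. \<exists>a. 0 < a \<and> a < \<epsilon> \<and> ?P a w \<and> d w z < \<epsilon>"
  proof (rule ex_limit_of_approximations[of ?P 5])
    show "\<exists>z\<in>X. ?P \<epsilon> z" if "\<epsilon> > 0" for \<epsilon> using approx_meet[OF x y that] by blast
    show "d z w \<le> 5 * (a + b)" if "z \<in> X" "w \<in> X" "?P a z" "?P b w" for a b z w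
      using that x y by (intro approx_meets_close[of x y]) auto
  qed (use complete in auto)
  \<comment> \<open>The limit of almost lower bounds is a lower bound, as the join is continuous; \<open>u\<close> will be
    \<open>x\<close> and \<open>y\<close>.\<close>
  have below: "d (u \<squnion> z) u \<le> 0"
    if u: "u \<in> X" and near: "\<And>a w. ?P a w \<Longrightarrow> d (u \<squnion> w) u < a" for u
  proof (rule field_le_epsilon)
    fix \<epsilon> :: real assume "\<epsilon> > 0"
    then obtain w a where w: "w \<in> X" "a < \<epsilon> / 2" "?P a w" "d w z < \<epsilon> / 2"
      using lim[of "\<epsilon> / 2"] by auto
    have "d (u \<squnion> z) u \<le> d (u \<squnion> z) (u \<squnion> w) + d (u \<squnion> w) u" using u z w by (intro triangle) auto
    also have "d (u \<squnion> z) (u \<squnion> w) \<le> d z w" using join_nonexpansive[of u u z w] u z w by simp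
    finally show "d (u \<squnion> z) u \<le> 0 + \<epsilon>" using near[OF w(3)] w by (simp add: commute)
  qed
  have "d (x \<squnion> z) x = 0" "d (y \<squnion> z) y = 0"
    using below[OF x] below[OF y] nonneg[of "x \<squnion> z" x] nonneg[of "y \<squnion> z" y] by auto
  then have le: "x \<squnion> z = x" "y \<squnion> z = y" using x y z by auto
  have "nrm x + nrm y \<le> nrm (x \<squnion> y) + nrm z"
  proof (rule field_le_epsilon)
    fix \<epsilon> :: real assume "\<epsilon> > 0"
    then obtain w a where w: "w \<in> X" "a < \<epsilon> / 2" "?P a w" "d w z < \<epsilon> / 2"
      using lim[of "\<epsilon> / 2"] by auto
    have "nrm w \<le> nrm z + d w z" using nrm_diff_le[OF w(1) z] by simp
    then show "nrm x + nrm y \<le> nrm (x \<squnion> y) + nrm z + \<epsilon>" using w by simp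
  qed
  moreover have "nrm z \<le> nrm x + nrm y - nrm (x \<squnion> y)"
    using nrm_le_near[OF x y z] le x y by simp
  ultimately show thesis using that[OF z] le x y z by (simp add: join_commute[of z])
qed

text \<open>The meet is described by its order property and not through \<open>ex_meet\<close>, so that it
  coincides with \<open>L_meet\<close> by unfolding definitions.\<close>

definition meet :: "'a \<Rightarrow> 'a \<Rightarrow> 'a" (infixl "\<sqinter>" 70) where
  "x \<sqinter> y = (THE z. z \<in> X \<and> z \<sqsubseteq> x \<and> z \<sqsubseteq> y \<and> (\<forall>w\<in>X. w \<sqsubseteq> x \<and> w \<sqsubseteq> y \<longrightarrow> w \<sqsubseteq> z))"

lemma meet_eqI:
  assumes "z \<in> X" "z \<sqsubseteq> x" "z \<sqsubseteq> y" "\<And>w. w \<in> X \<Longrightarrow> w \<sqsubseteq> x \<Longrightarrow> w \<sqsubseteq> y \<Longrightarrow> w \<sqsubseteq> z"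
  shows "x \<sqinter> y = z"
  unfolding meet_def
proof (rule the_equality)
  fix u assume "u \<in> X \<and> u \<sqsubseteq> x \<and> u \<sqsubseteq> y \<and> (\<forall>w\<in>X. w \<sqsubseteq> x \<and> w \<sqsubseteq> y \<longrightarrow> w \<sqsubseteq> u)"
  then show "u = z" using assms by (metis join_commute)
qed (use assms in auto)

text \<open>The limit \<open>z\<close> of approximate meets is the greatest lower bound: for a lower bound \<open>w\<close>,
  \<open>w \<squnion> z\<close> is a lower bound as well and so has norm at most \<open>|z|\<close>; comparable elements of equal
  norm have distance \<open>0\<close>.\<close>

lemma meet_properties:
  assumes x: "x \<in> X" and y: "y \<in> X"
  shows meet_closed [simp]: "x \<sqinter> y \<in> X"
    and meet_le1: "x \<sqinter> y \<sqsubseteq> x"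
    and meet_le2: "x \<sqinter> y \<sqsubseteq> y"
    and meet_greatest: "\<And>w. w \<in> X \<Longrightarrow> w \<sqsubseteq> x \<Longrightarrow> w \<sqsubseteq> y \<Longrightarrow> w \<sqsubseteq> x \<sqinter> y"
    and nrm_meet: "nrm x + nrm y = nrm (x \<squnion> y) + nrm (x \<sqinter> y)"
proof -
  obtain z where z: "z \<in> X" "z \<sqsubseteq> x" "z \<sqsubseteq> y" and nz: "nrm x + nrm y = nrm (x \<squnion> y) + nrm z"
    using ex_meet[OF x y] by blast
  have greatest: "w \<sqsubseteq> z" if w: "w \<in> X" "w \<sqsubseteq> x" "w \<sqsubseteq> y" for w
  proof -
    have "x \<squnion> (w \<squnion> z) = x" "y \<squnion> (w \<squnion> z) = y"
      using w z x y by (metis join_assoc join_commute)+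
    then have "nrm (w \<squnion> z) \<le> nrm z" using nrm_le_near[OF x y, of "w \<squnion> z"] x y w z nz by simp
    then have "d (w \<squnion> z) z \<le> 0"
      using d_join[of z w] w z by (simp add: join_commute[of z w])
    then show ?thesis using nonneg[of "w \<squnion> z" z] w z by (metis join_closed order_antisym zero)
  qed
  have "x \<sqinter> y = z" using z greatest by (intro meet_eqI) auto
  then show "x \<sqinter> y \<in> X" "x \<sqinter> y \<sqsubseteq> x" "x \<sqinter> y \<sqsubseteq> y"
    "\<And>w. w \<in> X \<Longrightarrow> w \<sqsubseteq> x \<Longrightarrow> w \<sqsubseteq> y \<Longrightarrow> w \<sqsubseteq> x \<sqinter> y"
    "nrm x + nrm y = nrm (x \<squnion> y) + nrm (x \<sqinter> y)"
    using z nz greatest by auto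
qed

lemma le_trans: "x \<in> X \<Longrightarrow> y \<in> X \<Longrightarrow> z \<in> X \<Longrightarrow> x \<sqsubseteq> y \<Longrightarrow> y \<sqsubseteq> z \<Longrightarrow> x \<sqsubseteq> z"
  by (metis join_assoc)

lemma meet_commute: "x \<in> X \<Longrightarrow> y \<in> X \<Longrightarrow> x \<sqinter> y = y \<sqinter> x"
  by (intro meet_eqI) (auto simp: meet_le1 meet_le2 meet_greatest)

lemma meet_absorb1: "x \<in> X \<Longrightarrow> y \<in> X \<Longrightarrow> x \<sqsubseteq> y \<Longrightarrow> x \<sqinter> y = x"
  by (intro meet_eqI) (auto simp: join_idem)

lemma meet_assoc:
  assumes x: "x \<in> X" and y: "y \<in> X" and z: "z \<in> X"
  shows "x \<sqinter> (y \<sqinter> z) = (x \<sqinter> y) \<sqinter> z"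
proof (rule meet_eqI)
  let ?m = "(x \<sqinter> y) \<sqinter> z"
  have m: "?m \<in> X" using assms by simp
  have xy: "?m \<sqsubseteq> x \<sqinter> y" using assms by (simp add: meet_le1)
  show "?m \<in> X" by (rule m)
  show "?m \<sqsubseteq> x" using le_trans[OF _ _ _ xy meet_le1] assms by simp
  have "?m \<sqsubseteq> y" using le_trans[OF _ _ _ xy meet_le2] assms by simp
  moreover have "?m \<sqsubseteq> z" using assms by (simp add: meet_le2)
  ultimately show "?m \<sqsubseteq> y \<sqinter> z" using assms by (simp add: meet_greatest)
  fix w assume w: "w \<in> X" "w \<sqsubseteq> x" "w \<sqsubseteq> y \<sqinter> z"
  have "w \<sqsubseteq> y" using le_trans[OF w(1) _ _ w(3) meet_le1] assms by simp
  moreover have "w \<sqsubseteq> z" using le_trans[OF w(1) _ _ w(3) meet_le2] assms by simp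
  ultimately show "w \<sqsubseteq> ?m" using assms w by (simp add: meet_greatest)
qed

lemma d_eq_join_meet: "x \<in> X \<Longrightarrow> y \<in> X \<Longrightarrow> d x y = nrm (x \<squnion> y) - nrm (x \<sqinter> y)"
  using d_formula[of x y] nrm_meet[of x y] by simp

end


section \<open>From Boolean metric lattices to probability algebras\<close>

text \<open>The content of \<open>T_BML\<close>.  Distributivity is exact, since the infimum in it only expresses
  the meets through the predicate for \<open>d (xy) z\<close>.  Complements are approximate so far.\<close>

locale boolean_metric_lattice = modular_metric_lattice +
  assumes meet_join_distrib:
      "x \<in> X \<Longrightarrow> y \<in> X \<Longrightarrow> z \<in> X \<Longrightarrow> meet x (y \<squnion> z) = meet x y \<squnion> meet x z"
    and approx_compl: "x \<in> X \<Longrightarrow> \<epsilon> > 0 \<Longrightarrow> \<exists>y\<in>X. 1 - d x y < \<epsilon>"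
begin

lemma approx_compl_norms:
  assumes "x \<in> X" "y \<in> X" "1 - d x y < \<epsilon>"
  shows "1 - \<epsilon> < nrm (x \<squnion> y)" and "nrm (x \<sqinter> y) < \<epsilon>"
proof -
  have "nrm (x \<squnion> y) \<le> 1" using assms by (simp add: nrm_le_1)
  moreover have "0 \<le> nrm (x \<sqinter> y)" by simp
  ultimately show "1 - \<epsilon> < nrm (x \<squnion> y)" "nrm (x \<sqinter> y) < \<epsilon>"
    using d_eq_join_meet[OF assms(1,2)] assms(3) by linarith+
qed

text \<open>The error of the uniqueness proof \<open>y = y \<sqinter> (x \<squnion> w) = (y \<sqinter> x) \<squnion> (y \<sqinter> w) = y \<sqinter> w\<close> for
  complements: the first step costs less than \<open>b\<close> because \<open>x \<squnion> w\<close> is almost \<open>1\<close>, the last one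
  less than \<open>a\<close> because \<open>y \<sqinter> x\<close> is almost \<open>0\<close>.\<close>

lemma approx_compl_part:
  assumes x: "x \<in> X" and y: "y \<in> X" and w: "w \<in> X"
    and a: "1 - d x y < a" and b: "1 - d x w < b"
  shows "nrm y - nrm (y \<sqinter> w) < a + b"
proof -
  have "nrm y - nrm (y \<sqinter> (x \<squnion> w)) = nrm (y \<squnion> (x \<squnion> w)) - nrm (x \<squnion> w)"
    using nrm_meet[of y "x \<squnion> w"] x y w by simp
  also have "\<dots> < b"
    using nrm_le_1[of "y \<squnion> (x \<squnion> w)"] approx_compl_norms(1)[OF x w b] x y w by simp
  finally have "nrm y - nrm (y \<sqinter> (x \<squnion> w)) < b" .
  moreover have "nrm (y \<sqinter> (x \<squnion> w)) = nrm ((y \<sqinter> x) \<squnion> (y \<sqinter> w))"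
    using x y w by (simp add: meet_join_distrib)
  moreover have "nrm ((y \<sqinter> x) \<squnion> (y \<sqinter> w)) \<le> nrm (y \<sqinter> x) + nrm (y \<sqinter> w)"
  proof -
    have "0 \<le> nrm ((y \<sqinter> x) \<sqinter> (y \<sqinter> w))" by simp
    then show ?thesis using nrm_meet[of "y \<sqinter> x" "y \<sqinter> w"] x y w by (simp del: nonneg)
  qed
  moreover have "nrm (y \<sqinter> x) < a"
    using approx_compl_norms(2)[OF x y a] meet_commute[OF x y] by simp
  ultimately show ?thesis by linarith
qed

lemma approx_compls_close:
  assumes x: "x \<in> X" and y: "y \<in> X" and w: "w \<in> X"
    and a: "1 - d x y < a" and b: "1 - d x w < b"
  shows "d y w \<le> 2 * (a + b)"
proof -
  have "nrm w - nrm (y \<sqinter> w) < b + a"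
    using approx_compl_part[OF x w y b a] unfolding meet_commute[OF y w] .
  then have "d y w \<le> (a + b) + (b + a)"
    using approx_compl_part[OF x y w a b] d_eq_join_meet[OF y w] nrm_meet[OF y w] by linarith
  also have "\<dots> = 2 * (a + b)" by (simp only: mult_2 add.commute)
  finally show ?thesis .
qed

lemma ex_compl:
  assumes x: "x \<in> X"
  shows "\<exists>y\<in>X. x \<squnion> y = \<one> \<and> x \<sqinter> y = \<zero>"
proof -
  obtain y where y: "y \<in> X"
    and lim: "\<And>\<epsilon>. \<epsilon> > 0 \<Longrightarrow> \<exists>w\<in>X. \<exists>a. 0 < a \<and> a < \<epsilon> \<and> 1 - d x w < a \<and> d w y < \<epsilon>"
  proof (rule ex_limit_of_approximations[of "\<lambda>\<epsilon> y. 1 - d x y < \<epsilon>" 2])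
    show "\<exists>z\<in>X. 1 - d x z < \<epsilon>" if "\<epsilon> > 0" for \<epsilon> using approx_compl[OF x that] .
    show "d z w \<le> 2 * (a + b)"
      if "z \<in> X" "w \<in> X" "1 - d x z < a" "1 - d x w < b" for a b z w
      using approx_compls_close[OF x that] .
  qed (use complete in auto)
  have "1 \<le> d x y"
  proof (rule field_le_epsilon)
    fix \<epsilon> :: real assume "\<epsilon> > 0"
    then obtain w a where w: "w \<in> X" "a < \<epsilon> / 2" "1 - d x w < a" "d w y < \<epsilon> / 2"
      using lim[of "\<epsilon> / 2"] by auto
    then show "1 \<le> d x y + \<epsilon>"
      using triangle[of x y w] x y by (simp add: commute)
  qed
  moreover have "nrm (x \<squnion> y) \<le> 1" using x y by (simp add: nrm_le_1)
  moreover have "0 \<le> nrm (x \<sqinter> y)" by simp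
  ultimately have "nrm (x \<squnion> y) = 1" "nrm (x \<sqinter> y) = 0"
    using d_eq_join_meet[OF x y] by linarith+
  then show ?thesis using x y nrm_eq_1[of "x \<squnion> y"] by (intro bexI[of _ y]) auto
qed

definition compl :: "'a \<Rightarrow> 'a" where
  "compl x = (SOME y. y \<in> X \<and> x \<squnion> y = \<one> \<and> x \<sqinter> y = \<zero>)"

lemma compl_properties:
  assumes "x \<in> X"
  shows "compl x \<in> X \<and> x \<squnion> compl x = \<one> \<and> x \<sqinter> compl x = \<zero>"
  unfolding compl_def by (rule someI_ex) (use ex_compl[OF assms] in blast)

lemma join_meet_distrib:
  assumes x: "x \<in> X" and y: "y \<in> X" and z: "z \<in> X"
  shows "x \<squnion> (y \<sqinter> z) = (x \<squnion> y) \<sqinter> (x \<squnion> z)"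
proof -
  have "(x \<squnion> y) \<sqinter> (x \<squnion> z) = ((x \<squnion> y) \<sqinter> x) \<squnion> ((x \<squnion> y) \<sqinter> z)"
    using x y z by (simp add: meet_join_distrib)
  also have "(x \<squnion> y) \<sqinter> x = x" using x y by (simp add: meet_commute meet_absorb1 le_join)
  also have "(x \<squnion> y) \<sqinter> z = (x \<sqinter> z) \<squnion> (y \<sqinter> z)"
    using x y z meet_join_distrib[of z x y] by (simp add: meet_commute)
  also have "x \<squnion> ((x \<sqinter> z) \<squnion> (y \<sqinter> z)) = (x \<squnion> (x \<sqinter> z)) \<squnion> (y \<sqinter> z)"
    using x y z by (simp add: join_assoc)
  also have "x \<squnion> (x \<sqinter> z) = x" using x z meet_le1[of x z] by (simp add: join_commute)
  finally show ?thesis ..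
qed

sublocale probability_valuation X meet "(\<squnion>)" compl \<zero> \<one> nrm
proof unfold_locales
  fix x y assume "x \<in> X" "y \<in> X"
  then show "x \<squnion> y = y \<squnion> x" "x \<sqinter> y = y \<sqinter> x" "x \<squnion> (x \<sqinter> y) = x"
    "nrm x + nrm y = nrm (x \<squnion> y) + nrm (x \<sqinter> y)" "x \<sqinter> (x \<squnion> y) = x"
    using nrm_meet[of x y] meet_absorb1[OF _ _ le_join, of x y] meet_le1[of x y]
      join_commute[of x y] meet_commute[of x y] join_commute[of x "x \<sqinter> y"]
    by simp_all
next
  fix x y z assume xyz: "x \<in> X" "y \<in> X" "z \<in> X"
  show "x \<squnion> (y \<squnion> z) = (x \<squnion> y) \<squnion> z" using xyz by (simp only: join_assoc)
  show "x \<sqinter> (y \<sqinter> z) = (x \<sqinter> y) \<sqinter> z" using xyz by (rule meet_assoc)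
  show "x \<sqinter> (y \<squnion> z) = (x \<sqinter> y) \<squnion> (x \<sqinter> z)" using xyz by (rule meet_join_distrib)
  show "x \<squnion> (y \<sqinter> z) = (x \<squnion> y) \<sqinter> (x \<squnion> z)" using xyz by (rule join_meet_distrib)
next
  fix x assume x: "x \<in> X"
  show "x \<sqinter> \<one> = x" using x by (intro meet_absorb1 join_one one_closed)
qed (simp_all add: compl_properties join_zero nrm_one)

text \<open>In terms of the norm, complementation replaces \<open>|x|\<close> by \<open>1 - |x|\<close> and, by De Morgan's law,
  exchanges joins and meets; the formula for \<open>d\<close> is symmetric under this.\<close>

lemma d_compl:
  assumes x: "x \<in> X" and y: "y \<in> X"
  shows "d (compl x) (compl y) = d x y"
proof -
  have nrm_compl: "nrm (compl u) = 1 - nrm u" if "u \<in> X" for u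
    using nrm_meet[of u "compl u"] compl_properties[OF that] that by (simp add: nrm_one)
  show ?thesis
    using d_formula[of "compl x" "compl y"] x y compl_cap[OF x y] nrm_compl[of "x \<sqinter> y"]
      nrm_meet[OF x y] d_formula[OF x y]
    by (simp add: nrm_compl)
qed

text \<open>The isometry \<open>compl\<close> turns meets into joins, where the claim is an axiom.\<close>

lemma meet_nonexpansive:
  assumes "x \<in> X" "x' \<in> X" "y \<in> X" "y' \<in> X"
  shows "d (x \<sqinter> y) (x' \<sqinter> y') \<le> d x x' + d y y'"
proof -
  have "d (x \<sqinter> y) (x' \<sqinter> y') = d (compl (x \<sqinter> y)) (compl (x' \<sqinter> y'))"
    by (rule d_compl[symmetric]) (use assms in simp_all)
  also have "\<dots> = d (compl x \<squnion> compl y) (compl x' \<squnion> compl y')"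
    using assms by (simp only: compl_cap)
  also have "\<dots> \<le> d (compl x) (compl x') + d (compl y) (compl y')"
    using assms by (intro join_nonexpansive compl_closed)
  also have "\<dots> = d x x' + d y y'" using assms by (simp only: d_compl)
  finally show ?thesis .
qed

lemma d_eq_nrm_symdiff:
  assumes "x \<in> X" "y \<in> X"
  shows "d x y = nrm ((x \<sqinter> compl y) \<squnion> (compl x \<sqinter> y))"
  using mu_symdiff[OF assms] d_eq_join_meet[OF assms] by simp

end


section \<open>From probability algebras to Boolean metric lattices\<close>

text \<open>The greatest lower bound \<open>meet\<close> turns out to be the given operation \<open>\<sqinter>\<close>, and then
  distributivity and complements are those of the Boolean algebra.\<close>

lemma (in probability_valuation) boolean_metric_lattice_of_symdiff:
  assumes "Metric_space X d" and "Metric_space.mcomplete X d"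
    and cup_contract: "\<And>x y z. x \<in> X \<Longrightarrow> y \<in> X \<Longrightarrow> z \<in> X \<Longrightarrow> d (x \<squnion> z) (y \<squnion> z) \<le> d x y"
    and d_symdiff: "\<And>x y. x \<in> X \<Longrightarrow> y \<in> X \<Longrightarrow> d x y = \<mu> ((x \<sqinter> compl y) \<squnion> (compl x \<sqinter> y))"
  shows "boolean_metric_lattice X d (\<squnion>) \<zero> \<one>"
proof -
  interpret Metric_space X d by fact
  have d: "d x y = \<mu> (x \<squnion> y) - \<mu> (x \<sqinter> y)" if "x \<in> X" "y \<in> X" for x y
    using that by (simp add: d_symdiff mu_symdiff)
  have norm: "d x \<zero> = \<mu> x" if "x \<in> X" for x
    using that by (simp add: d cup_zero cap_zero mu_zero)
  have join: "d (x \<squnion> y) x = \<mu> (x \<squnion> y) - \<mu> x" if "x \<in> X" "y \<in> X" for x y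
  proof -
    have "(x \<squnion> y) \<squnion> x = x \<squnion> y"
      using that cup_commute[of "x \<squnion> y" x] by (simp add: cup_assoc cup_idem)
    moreover have "(x \<squnion> y) \<sqinter> x = x"
      using that cap_commute[of "x \<squnion> y" x] by (simp add: cap_absorb)
    ultimately show ?thesis using that by (simp add: d)
  qed
  have low: "x \<squnion> (x \<sqinter> y) = x" "y \<squnion> (x \<sqinter> y) = y" if "x \<in> X" "y \<in> X" for x y
    using cup_absorb[OF that] cup_absorb[OF that(2,1)] cap_commute[OF that] by metis+
  interpret modular_metric_lattice X d "(\<squnion>)" \<zero> \<one>
  proof unfold_locales
    show "mcomplete" by fact
    show "d \<zero> \<one> = 1" using norm[of \<one>] by (simp add: commute mu_one)
    fix x y z assume x: "x \<in> X" and y: "y \<in> X" and z: "z \<in> X"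
    show "d x y + d z \<zero> \<le> d (x \<squnion> y) \<zero> + d (x \<squnion> z) x + d (y \<squnion> z) y"
      using mu_cap_pair_le[OF x y z] mu_modular[OF x z] mu_modular[OF y z]
        cap_commute[OF x z] cap_commute[OF y z] x y z
      by (simp add: norm join d[OF x y])
  next
    fix x y and \<epsilon> :: real assume x: "x \<in> X" and y: "y \<in> X" and \<epsilon>: "\<epsilon> > 0"
    show "\<exists>z\<in>X. d x \<zero> + d y \<zero> < d (x \<squnion> y) \<zero> + d z \<zero> + \<epsilon> \<and> d (x \<squnion> z) x < \<epsilon> \<and> d (y \<squnion> z) y < \<epsilon>"
      using x y \<epsilon> mu_modular[OF x y] by (intro bexI[of _ "x \<sqinter> y"]) (auto simp: low norm)
  next
    fix x y assume x: "x \<in> X" and y: "y \<in> X"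
    show "d x y = d (x \<squnion> y) x + d (x \<squnion> y) y"
      using mu_modular[OF x y] join[OF x y] join[OF y x] x y
        cup_commute[OF x y] d[OF x y] by simp
    show "x \<squnion> y = y \<squnion> x" using x y by (rule cup_commute)
  qed (simp_all add: cup_zero cup_one cup_idem cup_assoc cup_contract)
  have meet_eq: "meet x y = x \<sqinter> y" if "x \<in> X" "y \<in> X" for x y
    using that low[OF that] by (intro meet_eqI) (simp_all add: cap_greatest cup_commute[of "x \<sqinter> y"])
  show ?thesis
  proof unfold_locales
    fix x y z assume "x \<in> X" "y \<in> X" "z \<in> X"
    then show "meet x (y \<squnion> z) = meet x y \<squnion> meet x z" by (simp add: meet_eq cap_cup_distrib)
  next
    fix x and \<epsilon> :: real assume "x \<in> X" "\<epsilon> > 0"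
    then show "\<exists>y\<in>X. 1 - d x y < \<epsilon>"
      by (intro bexI[of _ "compl x"]) (auto simp: d cup_compl cap_compl mu_one mu_zero)
  qed
qed


section \<open>Models of the theories\<close>

lemma monus_eq_0_iff: "a \<ominus> b = 0 \<longleftrightarrow> a \<le> b"
  by (auto simp: monus_def max_def)

lemma monus_nonneg: "0 \<le> a \<ominus> b"
  by (simp add: monus_def)

lemma monus_le: "a \<le> B \<Longrightarrow> 0 \<le> b \<Longrightarrow> 0 \<le> B \<Longrightarrow> a \<ominus> b \<le> B"
  by (simp add: monus_def)

lemma models_T_MML_d'_iff:
  assumes "L_structure M"
  shows "M \<Turnstile> T_MML \<and> \<sigma>_dd' M = 0 \<longleftrightarrow>
    modular_metric_lattice (L_sp M) (L_d M) (L_plus M) (L_zero M) (L_one M)"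
proof -
  let ?X = "L_sp M" and ?d = "L_d M" and ?p = "L_plus M" and ?z = "L_zero M" and ?o = "L_one M"
  interpret Metric_space ?X ?d by (rule Metric_space_mspace_mdist)
  have mem: "?z \<in> ?X" "?o \<in> ?X" "\<And>x y. x \<in> ?X \<Longrightarrow> y \<in> ?X \<Longrightarrow> ?p x y \<in> ?X"
    and comp: "mcomplete" and le1: "\<And>x y. x \<in> ?X \<Longrightarrow> y \<in> ?X \<Longrightarrow> ?d x y \<le> 1"
    using assms by (auto simp: L_structure_def metric_sort_def mcomplete_of_def)
  have ne: "?X \<noteq> {}" using mem by blast
  have le2: "x \<in> ?X \<Longrightarrow> y \<in> ?X \<Longrightarrow> ?d x y \<le> 2" for x y using le1[of x y] by simp
  note bnd = ne mem le1 le2 add_mono[OF le1 le1, simplified] monus_nonneg monus_le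
  have A1: "\<bar>?d ?z ?o - 1\<bar> = 0 \<longleftrightarrow> ?d ?z ?o = 1" by auto
  have A2: "(SUP x\<in>?X. ?d (?p x ?z) x + ?d (?p x ?o) ?o) = 0 \<longleftrightarrow>
      (\<forall>x\<in>?X. ?p x ?z = x) \<and> (\<forall>x\<in>?X. ?p x ?o = ?o)"
    by (subst SUP_eq_0_iff[where B = 2]) (auto simp: bnd add_nonneg_eq_0_iff)
  have A3: "(SUP x\<in>?X. ?d (?p x x) x) = 0 \<longleftrightarrow> (\<forall>x\<in>?X. ?p x x = x)"
    by (subst SUP_eq_0_iff[where B = 2]) (auto simp: bnd)
  have A4: "(SUP x\<in>?X. SUP y\<in>?X. ?d (?p x y) (?p y x)) = 0 \<longleftrightarrow>
      (\<forall>x\<in>?X. \<forall>y\<in>?X. ?p x y = ?p y x)"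
    by (subst SUP2_eq_0_iff[where B = 2]) (auto simp: bnd)
  have A5: "(SUP x\<in>?X. SUP y\<in>?X. SUP z\<in>?X. ?d (?p (?p x y) z) (?p x (?p y z))) = 0 \<longleftrightarrow>
      (\<forall>x\<in>?X. \<forall>y\<in>?X. \<forall>z\<in>?X. ?p (?p x y) z = ?p x (?p y z))"
    by (subst SUP3_eq_0_iff[where B = 2]) (auto simp: bnd)
  have A6: "(SUP x\<in>?X. SUP y\<in>?X. SUP z\<in>?X. ?d (?p x z) (?p y z) \<ominus> ?d x y) = 0 \<longleftrightarrow>
      (\<forall>x\<in>?X. \<forall>y\<in>?X. \<forall>z\<in>?X. ?d (?p x z) (?p y z) \<le> ?d x y)"
    by (subst SUP3_eq_0_iff[where B = 2]) (auto simp: bnd monus_eq_0_iff)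
  have A7: "(SUP x\<in>?X. SUP y\<in>?X. SUP z\<in>?X. (?d x y + ?d z ?z) \<ominus>
        (?d (?p x y) ?z + ?d (?p x z) x + ?d (?p y z) y)) = 0 \<longleftrightarrow>
      (\<forall>x\<in>?X. \<forall>y\<in>?X. \<forall>z\<in>?X. ?d x y + ?d z ?z \<le>
        ?d (?p x y) ?z + ?d (?p x z) x + ?d (?p y z) y)"
    by (subst SUP3_eq_0_iff[where B = 2]) (auto simp: bnd monus_eq_0_iff)
  have max_bnd: "0 \<le> max (L_norm M x + L_norm M y \<ominus> (L_norm M (?p x y) + L_norm M z))
      (max (?d (?p x z) x) (?d (?p y z) y)) \<and>
      max (L_norm M x + L_norm M y \<ominus> (L_norm M (?p x y) + L_norm M z))
      (max (?d (?p x z) x) (?d (?p y z) y)) \<le> 2" if "x \<in> ?X" "y \<in> ?X" "z \<in> ?X" for x y z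
    using that by (auto simp: bnd L_norm_def le_max_iff_disj)
  have max_iff: "max (L_norm M x + L_norm M y \<ominus> (L_norm M (?p x y) + L_norm M z))
      (max (?d (?p x z) x) (?d (?p y z) y)) < \<epsilon> \<longleftrightarrow>
      ?d x ?z + ?d y ?z < ?d (?p x y) ?z + ?d z ?z + \<epsilon> \<and> ?d (?p x z) x < \<epsilon> \<and> ?d (?p y z) y < \<epsilon>"
    if "0 < \<epsilon>" for x y z \<epsilon>
    using that by (auto simp: L_norm_def monus_def)
  have A8: "\<sigma>_mod M = 0 \<longleftrightarrow> (\<forall>x\<in>?X. \<forall>y\<in>?X. \<forall>\<epsilon>>0. \<exists>z\<in>?X.
      ?d x ?z + ?d y ?z < ?d (?p x y) ?z + ?d z ?z + \<epsilon> \<and> ?d (?p x z) x < \<epsilon> \<and> ?d (?p y z) y < \<epsilon>)"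
  proof -
    let ?g = "\<lambda>x y z. max (L_norm M x + L_norm M y \<ominus> (L_norm M (?p x y) + L_norm M z))
      (max (?d (?p x z) x) (?d (?p y z) y))"
    have "\<sigma>_mod M = 0 \<longleftrightarrow> (\<forall>x\<in>?X. \<forall>y\<in>?X. (INF z\<in>?X. ?g x y z) = 0)"
      unfolding \<sigma>_mod_def
      by (intro SUP2_eq_0_iff[where B = 2] INF_nonneg_bounded ne max_bnd)
    also have "\<dots> \<longleftrightarrow> (\<forall>x\<in>?X. \<forall>y\<in>?X. \<forall>\<epsilon>>0. \<exists>z\<in>?X. ?g x y z < \<epsilon>)"
      by (intro ball_cong refl INF_eq_0_iff[where B = 2] ne max_bnd)
    finally show ?thesis by (simp only: max_iff cong: imp_cong)
  qed
  have dd': "L_d' M x y \<le> 2 \<and> 0 \<le> L_d' M x y" if "x \<in> ?X" "y \<in> ?X" for x y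
    using that by (auto simp: L_d'_def bnd)
  have A9: "\<sigma>_dd' M = 0 \<longleftrightarrow> (\<forall>x\<in>?X. \<forall>y\<in>?X. ?d x y = ?d (?p x y) x + ?d (?p x y) y)"
  proof -
    have "0 \<le> \<bar>?d x y - L_d' M x y\<bar> \<and> \<bar>?d x y - L_d' M x y\<bar> \<le> 2" if "x \<in> ?X" "y \<in> ?X" for x y
      using dd'[OF that] le2[OF that] nonneg[of x y] unfolding abs_le_iff by linarith
    then have "\<sigma>_dd' M = 0 \<longleftrightarrow> (\<forall>x\<in>?X. \<forall>y\<in>?X. \<bar>?d x y - L_d' M x y\<bar> = 0)"
      unfolding \<sigma>_dd'_def by (intro SUP2_eq_0_iff[where B = 2] ne)
    then show ?thesis by (simp add: L_d'_def)
  qed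
  have "M \<Turnstile> T_MML \<and> \<sigma>_dd' M = 0 \<longleftrightarrow> modular_metric_lattice_axioms ?X ?d ?p ?z ?o"
    unfolding models_def T_MML_def T_ML_def modular_metric_lattice_axioms_def
    unfolding ball_Un ball_simps A1 A2 A3 A4 A5 A6 A7 A8 A9
    by (simp add: mem comp Ball_def)
  then show ?thesis
    by (simp add: modular_metric_lattice_def Metric_space_axioms)
qed

lemma L_meet_eq:
  assumes "modular_metric_lattice (L_sp M) (L_d M) (L_plus M) (L_zero M) (L_one M)"
  shows "L_meet M = modular_metric_lattice.meet (L_sp M) (L_plus M)"
  by (intro ext) (simp add: L_meet_def L_le_def modular_metric_lattice.meet_def[OF assms])

text \<open>Only the value of \<open>\<phi>\<^sub>m\<close> in models of \<open>T_MML\<close> is known, so the distributivity sentence can be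
  evaluated only after \<open>M\<close> is known to be such a model; \<open>d = d'\<close> has been added for the same
  reason, as it provides the meets and thus the bounds needed for the infima.\<close>

lemma models_T_BML_iff:
  assumes M: "L_structure M"
    and \<phi>: "M \<Turnstile> T_MML \<Longrightarrow> (\<And>x y z. x \<in> L_sp M \<Longrightarrow> y \<in> L_sp M \<Longrightarrow> z \<in> L_sp M \<Longrightarrow>
      \<phi>\<^sub>m M x y z = L_d M (L_meet M x y) z)"
  shows "M \<Turnstile> T_BML \<phi>\<^sub>m \<longleftrightarrow>
    boolean_metric_lattice (L_sp M) (L_d M) (L_plus M) (L_zero M) (L_one M)"
proof -
  let ?X = "L_sp M" and ?d = "L_d M" and ?p = "L_plus M"
  let ?MML = "modular_metric_lattice ?X ?d ?p (L_zero M) (L_one M)"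
  have split: "M \<Turnstile> T_BML \<phi>\<^sub>m \<longleftrightarrow> ?MML \<and> \<sigma>_dist \<phi>\<^sub>m M = 0 \<and> \<sigma>_wcom M = 0"
    using models_T_MML_d'_iff[OF M] by (auto simp: models_def T_BML_def)
  have "\<sigma>_dist \<phi>\<^sub>m M = 0 \<and> \<sigma>_wcom M = 0 \<longleftrightarrow>
      boolean_metric_lattice ?X ?d ?p (L_zero M) (L_one M)" if MML: ?MML
  proof -
    interpret modular_metric_lattice ?X ?d ?p "L_zero M" "L_one M" by (rule MML)
    note \<phi> = \<phi>[unfolded L_meet_eq[OF MML]]
    have T: "M \<Turnstile> T_MML" using MML models_T_MML_d'_iff[OF M] by blast
    have ne: "?X \<noteq> {}" using zero_closed by blast
    have le1: "?d x y \<le> 1" if "x \<in> ?X" "y \<in> ?X" for x y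
      using M that by (auto simp: L_structure_def metric_sort_def)
    let ?f = "\<lambda>x y z t w. max (\<phi>\<^sub>m M x y t) (max (\<phi>\<^sub>m M x z w) (\<phi>\<^sub>m M x (?p y z) (?p t w)))"
    have f: "?f x y z t w = max (?d (meet x y) t) (max (?d (meet x z) w)
        (?d (meet x (?p y z)) (?p t w)))"
      if "x \<in> ?X" "y \<in> ?X" "z \<in> ?X" "t \<in> ?X" "w \<in> ?X" for x y z t w
      using that by (simp add: \<phi>[OF T])
    have f_bnd: "0 \<le> ?f x y z t w \<and> ?f x y z t w \<le> 1"
      if "x \<in> ?X" "y \<in> ?X" "z \<in> ?X" "t \<in> ?X" "w \<in> ?X" for x y z t w
      using that by (auto simp: f le1 le_max_iff_disj)
    have INF_iff: "(INF t\<in>?X. INF w\<in>?X. ?f x y z t w) = 0 \<longleftrightarrow>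
        meet x (?p y z) = ?p (meet x y) (meet x z)"
      if x: "x \<in> ?X" and y: "y \<in> ?X" and z: "z \<in> ?X" for x y z
    proof -
      have bdd: "bdd_below ((\<lambda>w. ?f x y z t w) ` ?X)" if "t \<in> ?X" for t
        using f_bnd[OF x y z that] by (intro bdd_belowI2[where m = 0]) blast
      have "(INF t\<in>?X. INF w\<in>?X. ?f x y z t w) = 0 \<longleftrightarrow>
          (\<forall>\<epsilon>>0. \<exists>t\<in>?X. (INF w\<in>?X. ?f x y z t w) < \<epsilon>)"
        by (intro INF_eq_0_iff[where B = 1] INF_nonneg_bounded f_bnd x y z ne)
      also have "\<dots> \<longleftrightarrow> (\<forall>\<epsilon>>0. \<exists>t\<in>?X. \<exists>w\<in>?X. ?f x y z t w < \<epsilon>)"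
        by (intro all_cong bex_cong refl cINF_less_iff ne bdd)
      also have "\<dots> \<longleftrightarrow> meet x (?p y z) = ?p (meet x y) (meet x z)"
      proof
        \<comment> \<open>The join is nonexpansive, so \<open>t \<squnion> w\<close> is as close to \<open>xy + xz\<close> as \<open>t\<close> and \<open>w\<close>
          together are to \<open>xy\<close> and \<open>xz\<close>; this makes three errors in all.\<close>
        assume *: "\<forall>\<epsilon>>0. \<exists>t\<in>?X. \<exists>w\<in>?X. ?f x y z t w < \<epsilon>"
        have "?d (meet x (?p y z)) (?p (meet x y) (meet x z)) \<le> 0"
        proof (rule field_le_epsilon)
          fix \<epsilon> :: real assume "\<epsilon> > 0"
          then obtain t w where t: "t \<in> ?X" and w: "w \<in> ?X" and "?f x y z t w < \<epsilon> / 3"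
            using *[rule_format, of "\<epsilon> / 3"] by auto
          then have *: "?d (meet x y) t < \<epsilon> / 3" "?d (meet x z) w < \<epsilon> / 3"
              "?d (meet x (?p y z)) (?p t w) < \<epsilon> / 3"
            using x y z by (auto simp: f)
          have "?d (meet x (?p y z)) (?p (meet x y) (meet x z)) \<le>
              ?d (meet x (?p y z)) (?p t w) + ?d (?p t w) (?p (meet x y) (meet x z))"
            using x y z t w by (intro triangle) auto
          also have "?d (?p t w) (?p (meet x y) (meet x z)) \<le> ?d t (meet x y) + ?d w (meet x z)"
            using x y z t w by (intro join_nonexpansive) auto
          finally show "?d (meet x (?p y z)) (?p (meet x y) (meet x z)) \<le> 0 + \<epsilon>"
            using * by (simp add: commute)
        qed
        then show "meet x (?p y z) = ?p (meet x y) (meet x z)"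
          using x y z nonneg by (metis zero join_closed meet_closed order_antisym)
      next
        assume "meet x (?p y z) = ?p (meet x y) (meet x z)"
        then have "?f x y z (meet x y) (meet x z) = 0" using x y z by (simp add: f)
        then show "\<forall>\<epsilon>>0. \<exists>t\<in>?X. \<exists>w\<in>?X. ?f x y z t w < \<epsilon>"
          using x y z by (metis meet_closed)
      qed
      finally show ?thesis .
    qed
    have dist: "\<sigma>_dist \<phi>\<^sub>m M = 0 \<longleftrightarrow> (\<forall>x\<in>?X. \<forall>y\<in>?X. \<forall>z\<in>?X.
        meet x (?p y z) = ?p (meet x y) (meet x z))"
    proof -
      have "\<sigma>_dist \<phi>\<^sub>m M = 0 \<longleftrightarrow>
          (\<forall>x\<in>?X. \<forall>y\<in>?X. \<forall>z\<in>?X. (INF t\<in>?X. INF w\<in>?X. ?f x y z t w) = 0)"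
        unfolding \<sigma>_dist_def
        by (intro SUP3_eq_0_iff[where B = 1] INF_nonneg_bounded f_bnd ne)
      then show ?thesis by (simp add: INF_iff)
    qed
    have wcom: "\<sigma>_wcom M = 0 \<longleftrightarrow> (\<forall>x\<in>?X. \<forall>\<epsilon>>0. \<exists>y\<in>?X. 1 - ?d x y < \<epsilon>)"
    proof -
      have b: "0 \<le> 1 - ?d x y \<and> 1 - ?d x y \<le> 1" if "x \<in> ?X" "y \<in> ?X" for x y
        using that le1 by simp
      have "\<sigma>_wcom M = 0 \<longleftrightarrow> (\<forall>x\<in>?X. (INF y\<in>?X. 1 - ?d x y) = 0)"
        unfolding \<sigma>_wcom_def by (intro SUP_eq_0_iff[where B = 1] INF_nonneg_bounded b ne)
      also have "\<dots> \<longleftrightarrow> (\<forall>x\<in>?X. \<forall>\<epsilon>>0. \<exists>y\<in>?X. 1 - ?d x y < \<epsilon>)"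
        by (intro ball_cong refl INF_eq_0_iff[where B = 1] b ne)
      finally show ?thesis .
    qed
    show ?thesis
      unfolding dist wcom boolean_metric_lattice_def boolean_metric_lattice_axioms_def
      using MML by blast
  qed
  then show ?thesis using split by (auto dest: boolean_metric_lattice.axioms(1))
qed

text \<open>The fifth measure axiom uses truncated subtraction.  The two monotonicity axioms before it
  make the truncation harmless, and the axiom becomes modularity.  In the other direction
  monotonicity has to be derived from modularity.\<close>

lemma models_PR_iff:
  assumes N: "Lpr_structure N"
  shows "N \<Turnstile> PR \<longleftrightarrow>
    probability_valuation (P_sp N) (P_cap N) (P_cup N) (P_compl N) (P_zero N) (P_one N) (P_mu N) \<and>
    (\<forall>x\<in>P_sp N. \<forall>y\<in>P_sp N. P_d N x y = P_mu N (P_symdiff N x y))"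
    (is "_ \<longleftrightarrow> ?V \<and> ?S")
proof -
  let ?X = "P_sp N" and ?d = "P_d N" and ?cap = "P_cap N" and ?cup = "P_cup N"
    and ?c = "P_compl N" and ?z = "P_zero N" and ?o = "P_one N" and ?m = "P_mu N"
  have mem: "?z \<in> ?X" "?o \<in> ?X" "\<And>x. x \<in> ?X \<Longrightarrow> ?c x \<in> ?X"
      "\<And>x y. x \<in> ?X \<Longrightarrow> y \<in> ?X \<Longrightarrow> ?cap x y \<in> ?X"
      "\<And>x y. x \<in> ?X \<Longrightarrow> y \<in> ?X \<Longrightarrow> ?cup x y \<in> ?X"
    and m: "\<And>x. x \<in> ?X \<Longrightarrow> 0 \<le> ?m x" "\<And>x. x \<in> ?X \<Longrightarrow> ?m x \<le> 1"
    and le1: "\<And>x y. x \<in> ?X \<Longrightarrow> y \<in> ?X \<Longrightarrow> ?d x y \<le> 1"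
    using N by (auto simp: Lpr_structure_def metric_sort_def)
  have ne: "?X \<noteq> {}" using mem by blast
  have id1: "(SUP x\<in>?X. ?d (s x) (t x)) = 0 \<longleftrightarrow> (\<forall>x\<in>?X. s x = t x)"
    if "\<And>x. x \<in> ?X \<Longrightarrow> s x \<in> ?X" "\<And>x. x \<in> ?X \<Longrightarrow> t x \<in> ?X" for s t
    using that by (subst SUP_eq_0_iff[where B = 1]) (auto simp: ne le1)
  have id2: "(SUP x\<in>?X. SUP y\<in>?X. ?d (s x y) (t x y)) = 0 \<longleftrightarrow> (\<forall>x\<in>?X. \<forall>y\<in>?X. s x y = t x y)"
    if "\<And>x y. x \<in> ?X \<Longrightarrow> y \<in> ?X \<Longrightarrow> s x y \<in> ?X" "\<And>x y. x \<in> ?X \<Longrightarrow> y \<in> ?X \<Longrightarrow> t x y \<in> ?X" for s t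
    using that by (subst SUP2_eq_0_iff[where B = 1]) (auto simp: ne le1)
  have id3: "(SUP x\<in>?X. SUP y\<in>?X. SUP z\<in>?X. ?d (s x y z) (t x y z)) = 0 \<longleftrightarrow>
      (\<forall>x\<in>?X. \<forall>y\<in>?X. \<forall>z\<in>?X. s x y z = t x y z)"
    if "\<And>x y z. x \<in> ?X \<Longrightarrow> y \<in> ?X \<Longrightarrow> z \<in> ?X \<Longrightarrow> s x y z \<in> ?X"
      "\<And>x y z. x \<in> ?X \<Longrightarrow> y \<in> ?X \<Longrightarrow> z \<in> ?X \<Longrightarrow> t x y z \<in> ?X" for s t
    using that by (subst SUP3_eq_0_iff[where B = 1]) (auto simp: ne le1)
  have bool: "N \<Turnstile> boolean_algebra_axioms \<longleftrightarrow> carrier_boolean_algebra ?X ?cap ?cup ?c ?z ?o"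
    unfolding models_def boolean_algebra_axioms_def carrier_boolean_algebra_def
    by (simp add: id1 id2 id3 mem) (simp add: Ball_def)
  have diff: "\<bar>a - b\<bar> \<le> 1" if "0 \<le> a" "0 \<le> b" "a \<le> 1" "b \<le> 1" for a b :: real
    using that by auto
  have M3: "(SUP x\<in>?X. SUP y\<in>?X. ?m (?cap x y) \<ominus> ?m x) = 0 \<longleftrightarrow>
      (\<forall>x\<in>?X. \<forall>y\<in>?X. ?m (?cap x y) \<le> ?m x)"
    by (subst SUP2_eq_0_iff[where B = 1]) (auto simp: ne mem m monus_nonneg monus_le monus_eq_0_iff)
  have M4: "(SUP x\<in>?X. SUP y\<in>?X. ?m x \<ominus> ?m (?cup x y)) = 0 \<longleftrightarrow>
      (\<forall>x\<in>?X. \<forall>y\<in>?X. ?m x \<le> ?m (?cup x y))"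
    by (subst SUP2_eq_0_iff[where B = 1]) (auto simp: ne mem m monus_nonneg monus_le monus_eq_0_iff)
  have M5: "(SUP x\<in>?X. SUP y\<in>?X. \<bar>(?m x \<ominus> ?m (?cap x y)) - (?m (?cup x y) \<ominus> ?m y)\<bar>) = 0 \<longleftrightarrow>
      (\<forall>x\<in>?X. \<forall>y\<in>?X. ?m x \<ominus> ?m (?cap x y) = ?m (?cup x y) \<ominus> ?m y)"
    by (subst SUP2_eq_0_iff[where B = 1]) (auto simp: ne mem m monus_nonneg monus_le intro!: diff)
  have S: "(SUP x\<in>?X. SUP y\<in>?X. \<bar>?d x y - ?m (P_symdiff N x y)\<bar>) = 0 \<longleftrightarrow> ?S"
    by (subst SUP2_eq_0_iff[where B = 1]) (auto simp: ne mem m le1 P_symdiff_def intro!: diff)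
  have meas: "N \<Turnstile> measure_axioms \<longleftrightarrow> ?m ?z = 0 \<and> ?m ?o = 1 \<and>
      (\<forall>x\<in>?X. \<forall>y\<in>?X. ?m (?cap x y) \<le> ?m x) \<and> (\<forall>x\<in>?X. \<forall>y\<in>?X. ?m x \<le> ?m (?cup x y)) \<and>
      (\<forall>x\<in>?X. \<forall>y\<in>?X. ?m x \<ominus> ?m (?cap x y) = ?m (?cup x y) \<ominus> ?m y)"
    unfolding models_def measure_axioms_def by (simp add: M3 M4 M5)
  have "N \<Turnstile> PR \<longleftrightarrow> N \<Turnstile> boolean_algebra_axioms \<and> N \<Turnstile> measure_axioms \<and> ?S"
    using S by (auto simp: models_def PR_def)
  also have "\<dots> \<longleftrightarrow> ?V \<and> ?S"
  proof (intro iffI; elim conjE)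
    assume B: "N \<Turnstile> boolean_algebra_axioms" and "N \<Turnstile> measure_axioms" and ?S
    then have mono: "\<And>x y. x \<in> ?X \<Longrightarrow> y \<in> ?X \<Longrightarrow> ?m (?cap x y) \<le> ?m x"
        "\<And>x y. x \<in> ?X \<Longrightarrow> y \<in> ?X \<Longrightarrow> ?m x \<le> ?m (?cup x y)"
      and eq: "\<And>x y. x \<in> ?X \<Longrightarrow> y \<in> ?X \<Longrightarrow> ?m x \<ominus> ?m (?cap x y) = ?m (?cup x y) \<ominus> ?m y"
      and ends: "?m ?z = 0" "?m ?o = 1"
      unfolding meas by blast+
    interpret carrier_boolean_algebra ?X ?cap ?cup ?c ?z ?o using B bool by blast
    have "probability_valuation_axioms ?X ?cap ?cup ?z ?o ?m"
    proof
      fix x y assume x: "x \<in> ?X" and y: "y \<in> ?X"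
      have "?m y \<le> ?m (?cup x y)" using mono(2)[OF y x] x y by (simp add: cup_commute)
      then show "?m x + ?m y = ?m (?cup x y) + ?m (?cap x y)"
        using mono(1)[OF x y] eq[OF x y] by (simp add: monus_def)
    qed (auto simp: ends m)
    then show "?V \<and> ?S"
      using \<open>?S\<close> carrier_boolean_algebra_axioms by (simp add: probability_valuation_def)
  next
    assume V: ?V and ?S
    interpret probability_valuation ?X ?cap ?cup ?c ?z ?o ?m by (rule V)
    have "?m x \<ominus> ?m (?cap x y) = ?m (?cup x y) \<ominus> ?m y" if "x \<in> ?X" "y \<in> ?X" for x y
      using mu_modular[OF that] by (simp add: monus_def algebra_simps)
    then have "N \<Turnstile> measure_axioms"
      unfolding meas by (simp add: mu_zero mu_one mu_cap_le mu_le_cup)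
    then show "N \<Turnstile> boolean_algebra_axioms \<and> N \<Turnstile> measure_axioms \<and> ?S"
      using \<open>?S\<close> bool carrier_boolean_algebra_axioms by blast
  qed
  finally show ?thesis .
qed

lemma has_modulus1I:
  assumes "\<And>x x'. x \<in> mspace m \<Longrightarrow> x' \<in> mspace m \<Longrightarrow> e (f x) (f x') \<le> mdist m x x'"
  shows "has_modulus1 m e f (\<lambda>\<epsilon>. \<epsilon>)"
  unfolding has_modulus1_def using assms by (meson order_trans)

text \<open>A function that is nonexpansive for the sum of the two distances has modulus half of the
  accuracy, since each of the two arguments may use up one half.\<close>

lemma has_modulus2I:
  assumes "\<And>x x' y y'. x \<in> mspace m \<Longrightarrow> x' \<in> mspace m \<Longrightarrow> y \<in> mspace m \<Longrightarrow> y' \<in> mspace m \<Longrightarrow>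
    e (f x y) (f x' y') \<le> mdist m x x' + mdist m y y'"
  shows "has_modulus2 m e f (\<lambda>\<epsilon>. \<epsilon> / 2)"
  unfolding has_modulus2_def
proof (intro allI impI ballI, elim conjE)
  fix \<epsilon> x x' y y'
  assume "x \<in> mspace m" "x' \<in> mspace m" "y \<in> mspace m" "y' \<in> mspace m"
    and "mdist m x x' \<le> \<epsilon> / 2" "mdist m y y' \<le> \<epsilon> / 2"
  then show "e (f x y) (f x' y') \<le> \<epsilon>" using assms[of x x' y y'] by simp
qed

theorem proposition5p21:
  fixes M :: "'a L_struct"
    and \<phi>\<^sub>m :: "'a L_struct \<Rightarrow> 'a \<Rightarrow> 'a \<Rightarrow> 'a \<Rightarrow> real"
  assumes "L_definable3 \<phi>\<^sub>m"
    and "\<And>N x y z. L_structure N \<Longrightarrow> N \<Turnstile> T_MML \<Longrightarrow> x \<in> L_sp N \<Longrightarrow> y \<in> L_sp N \<Longrightarrow> z \<in> L_sp N \<Longrightarrow>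
           \<phi>\<^sub>m N x y z = L_d N (L_meet N x y) z"
    and "L_structure M"
  shows "M \<Turnstile> T_BML \<phi>\<^sub>m \<longleftrightarrow>
           (\<exists>cap compl \<mu>. Lpr_structure (view_as_Lpr M cap compl \<mu>) \<and>
                          view_as_Lpr M cap compl \<mu> \<Turnstile> PR)"
proof -
  have sort: "metric_sort (L_met M)" and
    nonexp: "\<And>x x' y y'. x \<in> L_sp M \<Longrightarrow> x' \<in> L_sp M \<Longrightarrow> y \<in> L_sp M \<Longrightarrow> y' \<in> L_sp M \<Longrightarrow>
      L_d M (L_plus M x y) (L_plus M x' y') \<le> L_d M x x' + L_d M y y'"
    using assms(3) by (auto simp: L_structure_def)
  have "M \<Turnstile> T_BML \<phi>\<^sub>m \<longleftrightarrow>
      boolean_metric_lattice (L_sp M) (L_d M) (L_plus M) (L_zero M) (L_one M)"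
    using assms(2)[OF assms(3)] by (intro models_T_BML_iff assms(3))
  also have "\<dots> \<longleftrightarrow> (\<exists>cap compl \<mu>. Lpr_structure (view_as_Lpr M cap compl \<mu>) \<and>
      view_as_Lpr M cap compl \<mu> \<Turnstile> PR)"
  proof
    assume "boolean_metric_lattice (L_sp M) (L_d M) (L_plus M) (L_zero M) (L_one M)"
    then interpret boolean_metric_lattice "L_sp M" "L_d M" "L_plus M" "L_zero M" "L_one M" .
    let ?N = "view_as_Lpr M meet compl nrm"
    have N: "Lpr_structure ?N"
      unfolding Lpr_structure_def view_as_Lpr_def
      using sort
      by (auto simp: nrm_le_1 nrm_diff_le d_compl dist_real_def meet_nonexpansive nonexp
          intro!: has_modulus1I has_modulus2I)
    moreover have "?N \<Turnstile> PR"
      unfolding models_PR_iff[OF N]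
      unfolding view_as_Lpr_def P_symdiff_def Lpr_struct.select_convs
      by (intro conjI ballI probability_valuation_axioms d_eq_nrm_symdiff)
    ultimately show "\<exists>cap compl \<mu>. Lpr_structure (view_as_Lpr M cap compl \<mu>) \<and>
        view_as_Lpr M cap compl \<mu> \<Turnstile> PR" by blast
  next
    assume "\<exists>cap compl \<mu>. Lpr_structure (view_as_Lpr M cap compl \<mu>) \<and>
        view_as_Lpr M cap compl \<mu> \<Turnstile> PR"
    then obtain cap compl \<mu> where N: "Lpr_structure (view_as_Lpr M cap compl \<mu>)"
      and PR: "view_as_Lpr M cap compl \<mu> \<Turnstile> PR" by blast
    have V: "probability_valuation (L_sp M) cap (L_plus M) compl (L_zero M) (L_one M) \<mu>"
      and S: "\<And>x y. x \<in> L_sp M \<Longrightarrow> y \<in> L_sp M \<Longrightarrow>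
        L_d M x y = \<mu> (L_plus M (cap x (compl y)) (cap (compl x) y))"
      using PR[unfolded models_PR_iff[OF N]] by (auto simp: view_as_Lpr_def P_symdiff_def)
    show "boolean_metric_lattice (L_sp M) (L_d M) (L_plus M) (L_zero M) (L_one M)"
    proof (rule probability_valuation.boolean_metric_lattice_of_symdiff[OF V])
      show "Metric_space (L_sp M) (L_d M)" by (rule Metric_space_mspace_mdist)
      show "Metric_space.mcomplete (L_sp M) (L_d M)"
        using sort by (simp add: metric_sort_def mcomplete_of_def)
      show "L_d M (L_plus M x z) (L_plus M y z) \<le> L_d M x y"
        if "x \<in> L_sp M" "y \<in> L_sp M" "z \<in> L_sp M" for x y z
        using nonexp[of x y z z] Metric_space.mdist_zero[OF Metric_space_mspace_mdist, of z "L_met M"] that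
        by simp
    qed (rule S)
  qed
  finally show ?thesis .
qed

end
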